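(* For all total functions $f:\{0,1\}^n\to\{0,1\}$, \[ \mathrm{Q}_0(f)=O\big(\mathrm{QS}(f)^5\log \mathrm{QS}(f)\big)=O\big(\mathrm{Q}(f)^5\log \mathrm{Q}(f)\big). \] Moreover, the zero-error quantum algorithm achieving this bound also outputs a certificate for $f(x)$ whenever it outputs $f(x)$ on input $x$.
   Context: Query model: for $x\in\{0,1\}^n$ the quantum oracle $O_x$ acts by $O_x|i,b\rangle=|i,b\oplus x_i\rangle$ for $i\in[n]$, $b\in\{0,1\}$ (tensored with the identity on any other registers). A $T$-query quantum algorithm is given by input-independent unitaries $U_0,\dots,U_T$ on $m$ qubits. On input $x$ it prepares $|\psi_x\rangle=U_TO_xU_{T-1}O_x\cdots U_1O_xU_0|0^m\rangle$. It may then measure this state to produce an output, or it may output the mixed state obtained by tracing out a fixed subset of the qubits. The trace distance between states is $\|\rho-\sigma\|_{tr}=\tfrac12\|\rho-\sigma\|_1$. $\mathrm{Q}(f)$ (bounded-error quantum query complexity) is the minimum $T$ such that some $T$-query algorithm outputs $f(x)$ with probability at least $2/3$ on every input $x$ in the domain. $\mathrm{Q}_0(f)$ (zero-error quantum query complexity) is the minimum number of queries of a quantum algorithm that, on every input $x$ in the domain, outputs either $f(x)$ or the symbol "?", never outputs a wrong value, and outputs "?" with probability at most $1/2$. $\mathrm{QS}(f)$ (quantum distinguishing complexity) is the smallest $k$ such that there is a $k$-query quantum algorithm that on each input $x\in\mathrm{Dom}(f)$ outputs a quantum state $\rho_x$ with $\|\rho_x-\rho_y\|_{tr}\ge 1/6$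 for all $x,y\in\mathrm{Dom}(f)$ with $f(x)\neq f(y)$. A certificate for $x$ is a set $S\subseteq[n]$ together with the values $x_i$ for $i\in S$, such that every $y$ in the domain agreeing with $x$ on $S$ satisfies $f(y)=f(x)$. *)

theory Defs
  imports Complex_Main "Jordan_Normal_Form.Matrix" "Jordan_Normal_Form.Schur_Decomposition"
begin

text \<open>Inputs x in {0,1}^n are Boolean lists of length n.  An algorithm works on
  m = q + 1 + w qubits; the basis state with label k < 2^m is read as follows:
  bits 0..w-1 form the workspace, bit w is the target qubit b, and bits
  w+1..w+q form the index register i = k div 2^(w+1), which must be able to
  address every i < n (n \<le> 2^q).  The oracle flips the target qubit by x_i
  when i < n and acts as the identity on index values i \<ge> n.\<close>

definition qdim :: "nat \<Rightarrow> nat \<Rightarrow> nat" where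
  "qdim q w = 2 ^ (q + 1 + w)"

definition oracle_target :: "nat \<Rightarrow> nat \<Rightarrow> bool list \<Rightarrow> nat \<Rightarrow> nat" where
  "oracle_target n w x k =
     (let i = k div 2 ^ (Suc w) in
      if i < n \<and> x ! i then xor k (2 ^ w) else k)"

definition oracle_mat :: "nat \<Rightarrow> nat \<Rightarrow> nat \<Rightarrow> bool list \<Rightarrow> complex mat" where
  "oracle_mat n q w x =
     mat (qdim q w) (qdim q w) (\<lambda>(k', k). if k' = oracle_target n w x k then 1 else 0)"

definition unitary_mat :: "nat \<Rightarrow> complex mat \<Rightarrow> bool" where
  "unitary_mat d U \<longleftrightarrow> U \<in> carrier_mat d d \<and> U * mat_adjoint U = 1\<^sub>m d \<and> mat_adjoint U * U = 1\<^sub>m d"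

definition valid_alg :: "nat \<Rightarrow> nat \<Rightarrow> nat \<Rightarrow> nat \<Rightarrow> (nat \<Rightarrow> complex mat) \<Rightarrow> bool" where
  "valid_alg n q w T Us \<longleftrightarrow> n \<le> 2 ^ q \<and> (\<forall>t\<le>T. unitary_mat (qdim q w) (Us t))"

fun alg_state :: "nat \<Rightarrow> nat \<Rightarrow> nat \<Rightarrow> (nat \<Rightarrow> complex mat) \<Rightarrow> bool list \<Rightarrow> nat \<Rightarrow> complex vec" where
  "alg_state n q w Us x 0 = Us 0 *\<^sub>v unit_vec (qdim q w) 0"
| "alg_state n q w Us x (Suc t) = Us (Suc t) *\<^sub>v (oracle_mat n q w x *\<^sub>v alg_state n q w Us x t)"

definition out_prob ::
  "nat \<Rightarrow> nat \<Rightarrow> nat \<Rightarrow> nat \<Rightarrow> (nat \<Rightarrow> complex mat) \<Rightarrow> (nat \<Rightarrow> 'o) \<Rightarrow> bool list \<Rightarrow> 'o \<Rightarrow> real" where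
  "out_prob n q w T Us dec x v =
     (\<Sum>k\<in>{k. k < qdim q w \<and> dec k = v}. (cmod (alg_state n q w Us x T $ k))\<^sup>2)"

text \<open>Output mixed state: trace out the qubits (bit positions) in S.  The reduced
  state is represented (isometrically) as a qdim q w square matrix supported on the
  basis labels whose S-bits are all zero.\<close>
definition reduced_state ::
  "nat \<Rightarrow> nat \<Rightarrow> nat \<Rightarrow> nat \<Rightarrow> (nat \<Rightarrow> complex mat) \<Rightarrow> nat set \<Rightarrow> bool list \<Rightarrow> complex mat" where
  "reduced_state n q w T Us S x =
     (let \<psi> = alg_state n q w Us x T; D = qdim q w in
      mat D D (\<lambda>(k, k').
        if (\<forall>p\<in>S. \<not> bit k p) \<and> (\<forall>p\<in>S. \<not> bit k' p) then
          (\<Sum>s\<in>{s. s < D \<and> (\<forall>p. bit s p \<longrightarrow> p \<in> S)}. (\<psi> $ (or k s)) * cnj (\<psi> $ (or k' s)))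
        else 0))"

definition trace_norm :: "nat \<Rightarrow> complex mat \<Rightarrow> real" where
  "trace_norm d A = (SOME t. \<exists>U V s. unitary_mat d U \<and> unitary_mat d V \<and> (\<forall>i<d. s i \<ge> 0) \<and>
       A = U * mat_diag d (\<lambda>i. complex_of_real (s i)) * mat_adjoint V \<and> t = (\<Sum>i<d. s i))"

definition trace_dist :: "nat \<Rightarrow> complex mat \<Rightarrow> complex mat \<Rightarrow> real" where
  "trace_dist d \<rho> \<sigma> = trace_norm d (\<rho> - \<sigma>) / 2"

definition Qb :: "nat \<Rightarrow> (bool list \<Rightarrow> bool) \<Rightarrow> nat" where
  "Qb n f = (LEAST T. \<exists>q w Us (dec :: nat \<Rightarrow> bool). valid_alg n q w T Us \<and>
      (\<forall>x. length x = n \<longrightarrow> out_prob n q w T Us dec x (f x) \<ge> 2/3))"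

text \<open>Zero-error: outputs Some b (= b) or None (= "?").\<close>
definition Q0 :: "nat \<Rightarrow> (bool list \<Rightarrow> bool) \<Rightarrow> nat" where
  "Q0 n f = (LEAST T. \<exists>q w Us (dec :: nat \<Rightarrow> bool option). valid_alg n q w T Us \<and>
      (\<forall>x. length x = n \<longrightarrow>
         out_prob n q w T Us dec x (Some (\<not> f x)) = 0 \<and>
         out_prob n q w T Us dec x None \<le> 1/2))"

definition QS :: "nat \<Rightarrow> (bool list \<Rightarrow> bool) \<Rightarrow> nat" where
  "QS n f = (LEAST T. \<exists>q w Us S. valid_alg n q w T Us \<and> S \<subseteq> {..<q + 1 + w} \<and>
      (\<forall>x y. length x = n \<longrightarrow> length y = n \<longrightarrow> f x \<noteq> f y \<longrightarrow>
         trace_dist (qdim q w) (reduced_state n q w T Us S x) (reduced_state n q w T Us S y) \<ge> 1/6))"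

definition is_certificate :: "nat \<Rightarrow> (bool list \<Rightarrow> bool) \<Rightarrow> bool list \<Rightarrow> (nat \<Rightarrow> bool option) \<Rightarrow> bool" where
  "is_certificate n f x c \<longleftrightarrow> dom c \<subseteq> {..<n} \<and> (\<forall>i\<in>dom c. c i = Some (x ! i)) \<and>
     (\<forall>y. length y = n \<longrightarrow> (\<forall>i\<in>dom c. c i = Some (y ! i)) \<longrightarrow> f y = f x)"

text \<open>The paper's growth function t^5 log t (with max 1 to handle t \<le> 1).\<close>
definition g5log :: "nat \<Rightarrow> real" where
  "g5log t = real t ^ 5 * max 1 (log 2 (real t))"

end

theory Submission
  imports Defs "Jordan_Normal_Form.Spectral_Radius" "HOL-Analysis.L2_Norm"
begin

text \<open>A total function \<open>f\<close> is evaluated, with a certificate, by a \<^emph>\<open>deterministic\<close> algorithm making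
  \<open>O(QS(f)\<^sup>4)\<close> queries, which is stronger than the bound of the theorem. The adversary argument,
  applied to the final states of a distinguishing algorithm with \<open>t\<close> queries, bounds two
  quantities by \<open>(144 t)\<^sup>2\<close>. With a star of disjoint sensitive blocks around one input it bounds
  block sensitivity. With the sensitive edges of a subcube on which \<open>f\<close> has full degree, weighted
  by Huang's eigenvector, it bounds the degree: the signed adjacency matrix of the \<open>d\<close>-cube has
  the eigenvalue \<open>sqrt d\<close> on a space of half the full dimension, and for \<open>f\<close> of full degree
  some eigenvector is supported on a set all of whose inner edges are sensitive. Finally, as
  observed by Midrijanis, repeatedly querying all variables of a maximal monomial of the restricted
  function finds in every round a new block sensitive at the unknown input, so that
  the number of queries is at most block sensitivity times degree.\<close>

section \<open>Huang's signed hypercube\<close>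

text \<open>Huang's theorem in its usual form yields an input whose sensitivity is at least the
  square root of the degree. Together with the bound on block sensitivity that only gives degree of
  order \<open>t^4\<close>, hence \<open>t^6\<close> queries. The loss is avoided by feeding the
  eigenvector itself into the adversary argument: its eigenvalue \<open>sqrt d\<close> is compared
  directly with \<open>c * T\<close>, so the degree is of order \<open>t^2\<close>, like block
  sensitivity, and the product is of order \<open>t^4\<close>. Both bounds rest on the single
  inequality \<open>distinguish\<close>, in which quantum states no longer occur; the states enter
  only when the locale is interpreted. The way back from a decision tree to a quantum algorithm is
  an exact reversible simulation that ends in one basis state. Its label determines all queries and
  answers, so value and certificate can be read off it.\<close>

lemma underdetermined_system_nontrivial_solution:
  fixes B :: "'a \<Rightarrow> 'b \<Rightarrow> real"
  assumes "finite R" "finite U" "card R < card U"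
  shows "\<exists>x. (\<exists>u\<in>U. x u \<noteq> 0) \<and> (\<forall>r\<in>R. (\<Sum>u\<in>U. B r u * x u) = 0)"
  using assms
proof (induction R arbitrary: U B rule: finite_induct)
  case empty
  then have "U \<noteq> {}" by auto
  then show ?case by (intro exI[of _ "\<lambda>_. 1"]) auto
next
  case (insert r R)
  show ?case
  proof (cases "\<forall>u\<in>U. B r u = 0")
    case True
    have "card R < card U" using insert by simp
    from insert.IH[OF insert.prems(1) this, of B] True show ?thesis by auto
  next
    case False
    then obtain u0 where u0: "u0 \<in> U" "B r u0 \<noteq> 0" by auto
    define U' where "U' = U - {u0}"
    have fin: "finite U'" and "card R < card U'"
      using insert u0 by (auto simp: U'_def)
    \<comment> \<open>Gaussian elimination: equation \<open>r\<close> has a pivot at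
      \<open>u0\<close> and removes that unknown from the other equations; one equation and one
      unknown disappear, so the excess of unknowns is kept.\<close>
    from insert.IH[OF this, of "\<lambda>s u. B s u - B s u0 * B r u / B r u0"]
    obtain x u1 where x: "u1 \<in> U'" "x u1 \<noteq> 0"
      "\<And>s. s \<in> R \<Longrightarrow> (\<Sum>u\<in>U'. (B s u - B s u0 * B r u / B r u0) * x u) = 0"
      by blast
    define y where "y = x(u0 := - (\<Sum>u\<in>U'. B r u * x u) / B r u0)"
    have split: "(\<Sum>u\<in>U. B s u * y u) = B s u0 * y u0 + (\<Sum>u\<in>U'. B s u * x u)" for s
    proof -
      have "(\<Sum>u\<in>U. B s u * y u) = B s u0 * y u0 + (\<Sum>u\<in>U'. B s u * y u)"
        unfolding U'_def using u0 insert.prems by (simp add: sum.remove)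
      also have "(\<Sum>u\<in>U'. B s u * y u) = (\<Sum>u\<in>U'. B s u * x u)"
        by (rule sum.cong) (auto simp: U'_def y_def)
      finally show ?thesis .
    qed
    have "(\<Sum>u\<in>U. B s u * y u) = 0" if "s \<in> insert r R" for s
    proof (cases "s = r")
      case True
      show ?thesis unfolding split True using u0 by (simp add: y_def)
    next
      case False
      with that have "s \<in> R" by auto
      from x(3)[OF this] have "(\<Sum>u\<in>U'. B s u * x u) = B s u0 / B r u0 * (\<Sum>u\<in>U'. B r u * x u)"
        by (simp add: algebra_simps sum_subtractf sum_distrib_left)
      then show ?thesis unfolding split by (simp add: y_def)
    qed
    moreover have "u1 \<in> U" "y u1 \<noteq> 0" using x by (auto simp: U'_def y_def)
    ultimately show ?thesis by blast
  qed
qed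

section \<open>Flips of the cube and the signed adjacency operator\<close>

definition flip :: "nat \<Rightarrow> nat set \<Rightarrow> nat set" where
  "flip i S = sym_diff S {i}"

lemma flip_flip [simp]: "flip i (flip i S) = S"
  by (auto simp: flip_def)

lemma flip_commute: "flip i (flip j S) = flip j (flip i S)"
  by (auto simp: flip_def)

lemma flip_in_Pow: "i \<in> M \<Longrightarrow> S \<in> Pow M \<Longrightarrow> flip i S \<in> Pow M"
  by (auto simp: flip_def)

lemma even_card_flip: "finite S \<Longrightarrow> even (card (flip i S)) \<longleftrightarrow> odd (card S)"
  by (cases "i \<in> S") (auto simp: flip_def card_Diff_singleton_if card_gt_0_iff Un_commute)

lemma sum_flip:
  assumes "i \<in> M"
  shows "(\<Sum>S\<in>Pow M. h (flip i S)) = (\<Sum>S\<in>Pow M. h S)"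
  by (rule sum.reindex_bij_witness[of _ "flip i" "flip i"])
    (use assms flip_in_Pow in auto)

lemma sum_alternating_Pow:
  fixes M :: "nat set"
  assumes "finite M" "M \<noteq> {}"
  shows "(\<Sum>S\<in>Pow M. (-1) ^ card S) = (0 :: int)"
proof -
  obtain i where i: "i \<in> M" using assms by auto
  have "(\<Sum>S\<in>Pow M. (-1) ^ card S) = (\<Sum>S\<in>Pow M. (-1 :: int) ^ card (flip i S))"
    by (rule sum_flip[OF i, symmetric])
  also have "\<dots> = (\<Sum>S\<in>Pow M. - ((-1) ^ card S))"
    by (rule sum.cong) (use assms in \<open>auto simp: minus_one_power_iff even_card_flip finite_subset\<close>)
  finally show ?thesis by (simp add: sum_negf)
qed

text \<open>The Jordan-Wigner sign: toggling \<open>i\<close> passes over every smaller element of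
  \<open>S\<close> at the price of a factor -1. This makes signed flips in different directions
  anticommute.\<close>

definition hsign :: "nat \<Rightarrow> nat set \<Rightarrow> real" where
  "hsign i S = (-1) ^ card {j \<in> S. j < i}"

lemma hsign_sq [simp]: "hsign i S * hsign i S = 1"
  by (simp add: hsign_def flip: power_mult_distrib)

lemma abs_hsign [simp]: "\<bar>hsign i S\<bar> = 1"
  by (simp add: hsign_def power_abs)

lemma hsign_flip:
  assumes "finite S"
  shows "hsign i (flip j S) = (if j < i then - hsign i S else hsign i S)"
proof (cases "j < i")
  case True
  have "{k \<in> flip j S. k < i} = flip j {k \<in> S. k < i}" using True by (auto simp: flip_def)
  with True assms show ?thesis
    by (simp add: hsign_def minus_one_power_iff even_card_flip)
next
  case False
  have "{k \<in> flip j S. k < i} = {k \<in> S. k < i}" using False by (auto simp: flip_def)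
  with False show ?thesis by (simp add: hsign_def)
qed

definition huang :: "nat set \<Rightarrow> (nat set \<Rightarrow> real) \<Rightarrow> nat set \<Rightarrow> real" where
  "huang M u S = (\<Sum>i\<in>M. hsign i S * u (flip i S))"

text \<open>For \<open>i\<close> different from \<open>j\<close> the two routes around a square of
  the cube carry opposite signs and cancel. What survives is flipping the same element twice, once
  for each element of \<open>M\<close>.\<close>

lemma huang_huang:
  assumes M: "finite M" and S: "S \<subseteq> M"
  shows "huang M (huang M u) S = real (card M) * u S"
proof -
  define w where "w i j = hsign i S * hsign j (flip i S) * u (flip j (flip i S))" for i j
  have fS: "finite S" using M S finite_subset by blast
  have anti: "w j i = - w i j" if "i \<noteq> j" for i j
    using that by (cases "i < j") (auto simp: w_def hsign_flip[OF fS] flip_commute[of i j])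
  have diag: "w i i = u S" for i
    by (simp add: w_def hsign_flip[OF fS])
  have "huang M (huang M u) S = (\<Sum>i\<in>M. \<Sum>j\<in>M. w i j)"
    by (simp add: huang_def w_def sum_distrib_left mult.assoc)
  also have "\<dots> = (\<Sum>i\<in>M. \<Sum>j\<in>M. (w i j + w j i) / 2)"
  proof -
    have "(\<Sum>i\<in>M. \<Sum>j\<in>M. w i j) = (\<Sum>i\<in>M. \<Sum>j\<in>M. w j i)" by (rule sum.swap)
    then show ?thesis by (simp add: sum.distrib flip: sum_divide_distrib)
  qed
  also have "\<dots> = (\<Sum>i\<in>M. \<Sum>j\<in>M. if i = j then u S else 0)"
  proof (intro sum.cong refl)
    fix i j show "(w i j + w j i) / 2 = (if i = j then u S else 0)"
      using anti[of i j] by (cases "i = j") (simp_all add: diag)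
  qed
  also have "\<dots> = real (card M) * u S" using M by simp
  finally show ?thesis .
qed

text \<open>As \<open>huang M\<close> squares to \<open>card M\<close>, adding \<open>sqrt (card M)\<close> to it maps every function to an
  eigenvector; functions supported on the sets that avoid a fixed \<open>m\<close> are mapped injectively.\<close>

lemma huang_eigenvector:
  assumes M: "finite M" "M \<noteq> {}"
    and V: "V \<subseteq> Pow M" "card (Pow M - V) < card V"
  shows "\<exists>v. (\<exists>S\<in>V. v S \<noteq> 0) \<and> (\<forall>S\<in>Pow M - V. v S = 0) \<and>
    (\<forall>S\<in>Pow M. huang M v S = sqrt (real (card M)) * v S)"
proof -
  obtain m where m: "m \<in> M" using M by auto
  define U where "U = Pow (M - {m})"
  define r where "r = sqrt (real (card M))"
  \<comment> \<open>The matrix of the operator \<open>huang M + r\<close>, with one column for the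
    indicator of each set in \<open>U\<close>. Its rows outside \<open>V\<close> are the conditions
    to be met; they are fewer than the columns, since \<open>U\<close> is half the cube and
    \<open>V\<close> more than half.\<close>
  define B where "B S u = huang M (\<lambda>R. of_bool (R = u)) S + r * of_bool (S = u)" for S u
  have finP: "finite (Pow M)" using M by simp
  have "card V + card (Pow M - V) = 2 ^ card M"
    using V finP by (metis card_Pow M(1) card_Diff_subset card_mono finite_subset le_add_diff_inverse)
  moreover have "2 ^ card M = 2 * (2::nat) ^ card (M - {m})"
    using M m by (metis card_Suc_Diff1 power_Suc)
  ultimately have "card (Pow M - V) < card U"
    using V M by (simp add: U_def card_Pow)
  moreover have "finite (Pow M - V)" "finite U" using M by (auto simp: U_def)
  ultimately obtain x u1 where u1: "u1 \<in> U" "x u1 \<noteq> 0"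
    and x: "\<And>S. S \<in> Pow M - V \<Longrightarrow> (\<Sum>u\<in>U. B S u * x u) = 0"
    using underdetermined_system_nontrivial_solution[of "Pow M - V" U B] by blast
  define y where "y S = (if S \<in> U then x S else 0)" for S
  define v where "v S = huang M y S + r * y S" for S
  have finU: "finite U" using M by (auto simp: U_def)
  have y_sum: "y S = (\<Sum>u\<in>U. of_bool (S = u) * x u)" for S
  proof -
    have "(\<Sum>u\<in>U. of_bool (S = u) * x u) = (\<Sum>u\<in>U. if S = u then x u else 0)"
      by (rule sum.cong) auto
    then show ?thesis using finU by (simp add: y_def)
  qed
  have v_B: "v S = (\<Sum>u\<in>U. B S u * x u)" for S
  proof -
    have "huang M y S = (\<Sum>i\<in>M. \<Sum>u\<in>U. hsign i S * of_bool (flip i S = u) * x u)"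
      unfolding huang_def by (subst y_sum) (simp add: sum_distrib_left mult.assoc)
    also have "\<dots> = (\<Sum>u\<in>U. huang M (\<lambda>R. of_bool (R = u)) S * x u)"
      unfolding huang_def by (subst sum.swap) (simp add: sum_distrib_right)
    finally have "huang M y S = (\<Sum>u\<in>U. huang M (\<lambda>R. of_bool (R = u)) S * x u)" .
    then show ?thesis
      unfolding v_def B_def y_sum[of S] by (simp add: sum.distrib distrib_right sum_distrib_left mult.assoc)
  qed
  have eig: "huang M v S = r * v S" if "S \<in> Pow M" for S
  proof -
    have "huang M v S = huang M (huang M y) S + r * huang M y S"
      unfolding v_def huang_def by (simp add: algebra_simps sum.distrib sum_distrib_left)
    also have "\<dots> = r * v S"
      using that M by (simp add: huang_huang v_def r_def algebra_simps)
    finally show ?thesis .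
  qed
  have mu1: "m \<notin> u1" "u1 \<subseteq> M" using u1 by (auto simp: U_def)
  \<comment> \<open>The witness that \<open>v\<close> is nonzero: every flip of \<open>S1\<close>
    other than at \<open>m\<close> keeps \<open>m\<close> and so stays outside the support
    \<open>U\<close> of \<open>y\<close>. Hence \<open>v S1\<close> is a single coefficient of
    \<open>x\<close> up to sign.\<close>
  define S1 where "S1 = flip m u1"
  have "huang M y S1 = (\<Sum>i\<in>M. if i = m then hsign m S1 * y u1 else 0)"
    unfolding huang_def
    by (rule sum.cong) (use mu1 in \<open>auto simp: S1_def y_def U_def flip_def\<close>)
  then have "v S1 = hsign m S1 * x u1"
    using m M mu1 u1 unfolding v_def by (simp add: y_def S1_def U_def flip_def)
  then have ne: "v S1 \<noteq> 0" using u1 by (simp add: hsign_def)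
  have "S1 \<in> Pow M" using mu1 m by (auto simp: S1_def flip_def)
  then have "S1 \<in> V" using ne x[of S1] v_B[of S1] by auto
  moreover have "\<forall>S\<in>Pow M - V. v S = 0" using x v_B by metis
  ultimately show ?thesis using ne eig unfolding r_def by blast
qed

section \<open>Maximal monomials\<close>

text \<open>Up to sign, the coefficient of the monomial \<open>M\<close> in the multilinear polynomial that agrees
  with \<open>F\<close> on the subcube through \<open>Z\<close> in the directions \<open>M\<close>.\<close>

definition alt_sum :: "(nat set \<Rightarrow> bool) \<Rightarrow> nat set \<Rightarrow> nat set \<Rightarrow> int" where
  "alt_sum F M Z = (\<Sum>S\<in>Pow M. (-1) ^ card S * of_bool (F ((Z - M) \<union> S)))"

lemma alt_sum_empty [simp]: "alt_sum F {} Z = of_bool (F Z)"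
  by (simp add: alt_sum_def)

lemma alt_sum_cong: "Z - M = Z' - M \<Longrightarrow> alt_sum F M Z = alt_sum F M Z'"
  by (simp add: alt_sum_def)

text \<open>Coefficients are iterated differences: the subsets that contain \<open>i\<close> have
  the opposite sign and live on the face where \<open>i\<close> is present.\<close>

lemma alt_sum_insert:
  assumes M: "finite M" and i: "i \<notin> M"
  shows "alt_sum F (insert i M) Z = alt_sum F M (Z - {i}) - alt_sum F M (insert i Z)"
proof -
  let ?g = "\<lambda>S. (-1) ^ card S * of_bool (F ((Z - insert i M) \<union> S)) :: int"
  have inj: "inj_on (insert i) (Pow M)"
    using i by (intro inj_onI) (metis PowD insert_ident subsetD)
  have "alt_sum F (insert i M) Z = sum ?g (Pow M \<union> insert i ` Pow M)"
    by (simp add: alt_sum_def Pow_insert)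
  also have "\<dots> = sum ?g (Pow M) + sum ?g (insert i ` Pow M)"
    by (rule sum.union_disjoint) (use M i in auto)
  also have "sum ?g (Pow M) = alt_sum F M (Z - {i})"
    unfolding alt_sum_def Diff_insert2[of Z i M] ..
  also have "sum ?g (insert i ` Pow M) = (\<Sum>S\<in>Pow M. ?g (insert i S))"
    by (simp add: sum.reindex[OF inj])
  also have "\<dots> = (\<Sum>S\<in>Pow M. - ((-1) ^ card S * of_bool (F ((insert i Z - M) \<union> S))))"
  proof (rule sum.cong)
    fix S assume S: "S \<in> Pow M"
    then have "card (insert i S) = Suc (card S)"
      using M i by (metis PowD card_insert_disjoint finite_subset subsetD)
    moreover have "(Z - insert i M) \<union> insert i S = (insert i Z - M) \<union> S"
      using i by auto
    ultimately show "?g (insert i S) = - ((-1) ^ card S * of_bool (F ((insert i Z - M) \<union> S)))"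
      by simp
  qed simp
  finally show ?thesis by (simp add: alt_sum_def sum_negf)
qed

text \<open>If \<open>F\<close> took only one value on the subcube through \<open>Z\<close> in the
  directions \<open>M\<close>, the alternating sum would be a multiple of the sum of all signs,
  which vanishes.\<close>

lemma alt_sum_sensitive_block:
  assumes M: "finite M" "M \<noteq> {}" and ne: "alt_sum F M Z \<noteq> 0"
  shows "\<exists>B\<subseteq>M. F (sym_diff Z B) \<noteq> F Z"
proof (rule ccontr)
  assume const: "\<not> ?thesis"
  have "F ((Z - M) \<union> S) = F Z" if "S \<subseteq> M" for S
  proof -
    have "sym_diff Z (sym_diff (Z \<inter> M) S) = (Z - M) \<union> S" using that by auto
    moreover have "sym_diff (Z \<inter> M) S \<subseteq> M" using that by auto
    ultimately show ?thesis using const by metis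
  qed
  then have "alt_sum F M Z = (\<Sum>S\<in>Pow M. (-1) ^ card S * of_bool (F Z))"
    unfolding alt_sum_def by (intro sum.cong) auto
  also have "\<dots> = (\<Sum>S\<in>Pow M. (-1) ^ card S) * of_bool (F Z)"
    by (rule sum_distrib_right[symmetric])
  finally show False using ne sum_alternating_Pow[OF M] by simp
qed

text \<open>The inputs consistent with a partial run: \<open>K\<close> holds the queried variables
  and \<open>P\<close> those among them that were answered 1.\<close>

definition subcube :: "nat \<Rightarrow> nat set \<Rightarrow> nat set \<Rightarrow> nat set set" where
  "subcube n K P = {Y. Y \<subseteq> {..<n} \<and> Y \<inter> K = P}"

text \<open>A monomial that is maximal in the expansion of \<open>F\<close> on the subcube keeps its coefficient
  under every further restriction of the other variables; only this consequence is recorded.\<close>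

definition max_monomial :: "nat \<Rightarrow> (nat set \<Rightarrow> bool) \<Rightarrow> nat set \<Rightarrow> nat set \<Rightarrow> nat set \<Rightarrow> bool" where
  "max_monomial n F K P M \<longleftrightarrow>
     M \<noteq> {} \<and> M \<subseteq> {..<n} - K \<and> (\<forall>Y\<in>subcube n K P. alt_sum F M Y \<noteq> 0)"

text \<open>Take \<open>M\<close> maximal among the sets whose coefficient is nonzero somewhere on
  the subcube. Moving in a free direction \<open>i\<close> outside \<open>M\<close> changes its
  coefficient by that of \<open>insert i M\<close>, which is 0 by maximality. So the coefficient is
  the same, nonzero, number on the whole subcube.\<close>

lemma max_monomial_exists:
  assumes XY: "X \<in> subcube n K P" "Y \<in> subcube n K P" "F X \<noteq> F Y"
  shows "\<exists>M. max_monomial n F K P M"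
proof -
  define C where "C = {M. M \<subseteq> {..<n} - K \<and> (\<exists>Y\<in>subcube n K P. alt_sum F M Y \<noteq> 0)}"
  have "finite C" unfolding C_def by (rule finite_subset[of _ "Pow {..<n}"]) auto
  moreover have "{} \<in> C" using XY by (cases "F X") (auto simp: C_def)
  ultimately obtain M where M: "M \<in> C" and max: "\<And>N. N \<in> C \<Longrightarrow> M \<subseteq> N \<Longrightarrow> N = M"
    using finite_has_maximal[of C] by (metis empty_iff)
  from M obtain Z where MK: "M \<subseteq> {..<n} - K" and Z: "Z \<in> subcube n K P" "alt_sum F M Z \<noteq> 0"
    by (auto simp: C_def)
  have finM: "finite M" using MK finite_subset by blast
  have step: "alt_sum F M (flip i Y) = alt_sum F M Y"
    if Y: "Y \<in> subcube n K P" and i: "i \<in> {..<n} - K - M" for i Y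
  proof -
    have "insert i M \<notin> C" using max[of "insert i M"] i by auto
    then have "alt_sum F (insert i M) Y = 0" using Y i MK by (auto simp: C_def)
    then have "alt_sum F M (Y - {i}) = alt_sum F M (insert i Y)"
      using alt_sum_insert[OF finM, of i F Y] i by simp
    then show ?thesis
      by (cases "i \<in> Y") (auto simp: flip_def insert_absorb Un_commute)
  qed
  have many: "alt_sum F M (sym_diff Z E) = alt_sum F M Z \<and> sym_diff Z E \<in> subcube n K P"
    if "finite E" "E \<subseteq> {..<n} - K - M" for E
    using that
  proof (induction E rule: finite_induct)
    case empty then show ?case using Z by simp
  next
    case (insert i E)
    have eq: "sym_diff Z (insert i E) = flip i (sym_diff Z E)" using insert by (auto simp: flip_def)
    have "flip i (sym_diff Z E) \<in> subcube n K P"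
      using insert by (auto simp: flip_def subcube_def)
    then show ?case unfolding eq using insert step[of "sym_diff Z E" i] by auto
  qed
  have all: "alt_sum F M Y \<noteq> 0" if Y: "Y \<in> subcube n K P" for Y
  proof -
    define E where "E = sym_diff Z Y - M"
    have E: "E \<subseteq> {..<n} - K - M" using Y Z unfolding E_def subcube_def by auto
    have "alt_sum F M Y = alt_sum F M (sym_diff Z E)"
      by (rule alt_sum_cong) (auto simp: E_def)
    also have "\<dots> = alt_sum F M Z" using many E finite_subset[OF E] by auto
    finally show ?thesis using Z by simp
  qed
  \<comment> \<open>The coefficient of the empty monomial is the value of \<open>F\<close> itself,
    which vanishes at one of \<open>X\<close> and \<open>Y\<close>.\<close>
  have "M \<noteq> {}" using all[OF XY(1)] all[OF XY(2)] XY(3) by auto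
  with all MK show ?thesis unfolding max_monomial_def by blast
qed

lemma sum_rotate3:
  "(\<Sum>a\<in>A. \<Sum>b\<in>B. \<Sum>c\<in>C. g a b c) = (\<Sum>c\<in>C. \<Sum>b\<in>B. \<Sum>a\<in>A. g a b c)"
proof -
  have "(\<Sum>a\<in>A. \<Sum>b\<in>B. \<Sum>c\<in>C. g a b c) = (\<Sum>b\<in>B. \<Sum>a\<in>A. \<Sum>c\<in>C. g a b c)"
    by (rule sum.swap)
  also have "\<dots> = (\<Sum>b\<in>B. \<Sum>c\<in>C. \<Sum>a\<in>A. g a b c)"
    by (intro sum.cong refl sum.swap)
  also have "\<dots> = (\<Sum>c\<in>C. \<Sum>b\<in>B. \<Sum>a\<in>A. g a b c)"
    by (rule sum.swap)
  finally show ?thesis .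
qed

section \<open>Deterministic queries from query weights\<close>

text \<open>\<open>p X t i\<close> is the probability of finding \<open>i\<close> in the index register just before query \<open>t\<close> on
  input \<open>X\<close>. The last assumption is all that is needed of the adversary argument.\<close>

locale query_weights =
  fixes n :: nat and F :: "nat set \<Rightarrow> bool" and T c :: nat
    and p :: "nat set \<Rightarrow> nat \<Rightarrow> nat \<Rightarrow> real"
  assumes weight_nonneg: "0 \<le> p X t i"
    and weight_le_1: "(\<Sum>i<n. p X t i) \<le> 1"
    and distinguish: "X \<subseteq> {..<n} \<Longrightarrow> Y \<subseteq> {..<n} \<Longrightarrow> F X \<noteq> F Y \<Longrightarrow>
      1 \<le> real c * (\<Sum>t<T. sqrt (\<Sum>i\<in>sym_diff X Y. p X t i) * sqrt (\<Sum>i\<in>sym_diff X Y. p Y t i))"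
begin

lemma weight_subset_le_1: "I \<subseteq> {..<n} \<Longrightarrow> (\<Sum>i\<in>I. p X t i) \<le> 1"
  by (rule order_trans[OF sum_mono2 weight_le_1]) (auto intro: weight_nonneg)

text \<open>Disjoint blocks share the query weight of the centre \<open>Z\<close>, which is at most
  1 at each time, while the neighbours' weights are merely bounded by 1. A typical block then sees
  weight \<open>1 / k\<close>, whose square root, summed over all blocks and times, yields
  \<open>k \<le> c * T * sqrt k\<close>.\<close>

lemma block_sensitivity_bound:
  assumes Z: "Z \<subseteq> {..<n}"
    and B: "\<And>j. j < k \<Longrightarrow> B j \<subseteq> {..<n}" "\<And>j. j < k \<Longrightarrow> F (sym_diff Z (B j)) \<noteq> F Z"
    and disj: "\<And>i j. i < k \<Longrightarrow> j < k \<Longrightarrow> i \<noteq> j \<Longrightarrow> B i \<inter> B j = {}"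
  shows "k \<le> (c * T)\<^sup>2"
proof (cases "k = 0")
  case False
  \<comment> \<open>The parameter for the arithmetic-geometric mean below. It balances the two
    terms: summed over the \<open>k\<close> blocks, \<open>s * b t j\<close> and
    \<open>1 / s\<close> contribute at most \<open>s\<close> each.\<close>
  define s where "s = sqrt (real k)"
  have s: "s > 0" "s * s = real k" using False by (auto simp: s_def)
  define b where "b t j = (\<Sum>i\<in>B j. p Z t i)" for t j
  have b0: "b t j \<ge> 0" for t j unfolding b_def by (intro sum_nonneg weight_nonneg)
  have sumb: "(\<Sum>j<k. b t j) \<le> 1" for t
  proof -
    have "(\<Sum>j<k. b t j) = (\<Sum>i\<in>(\<Union>j<k. B j). p Z t i)"
      unfolding b_def
      by (rule sum.UNION_disjoint[symmetric]) (use B disj in \<open>auto intro: finite_subset\<close>)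
    also have "\<dots> \<le> 1" by (rule weight_subset_le_1) (use B in auto)
    finally show ?thesis .
  qed
  have one: "1 \<le> real c * (\<Sum>t<T. (s * b t j + 1 / s) / 2)" if j: "j < k" for j
  proof -
    have Zj: "sym_diff Z (B j) \<subseteq> {..<n}" using Z B(1)[OF j] by auto
    have sd: "sym_diff Z (sym_diff Z (B j)) = B j" by auto
    have "1 \<le> real c * (\<Sum>t<T. sqrt (\<Sum>i\<in>B j. p Z t i) *
        sqrt (\<Sum>i\<in>B j. p (sym_diff Z (B j)) t i))"
      using distinguish[OF Z Zj] B(2)[OF j] unfolding sd by metis
    also have "\<dots> \<le> real c * (\<Sum>t<T. (s * b t j + 1 / s) / 2)"
    proof (intro mult_left_mono sum_mono)
      fix t
      have "sqrt (\<Sum>i\<in>B j. p Z t i) * sqrt (\<Sum>i\<in>B j. p (sym_diff Z (B j)) t i) \<le> sqrt (b t j) * 1"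
        unfolding b_def by (intro mult_left_mono) (auto intro!: weight_subset_le_1[OF B(1)[OF j]] sum_nonneg weight_nonneg)
      also have "sqrt (b t j) = sqrt ((s * b t j) * (1 / s))" using s by simp
      also have "\<dots> \<le> (s * b t j + 1 / s) / 2"
        by (rule arith_geo_mean_sqrt) (use s b0 in auto)
      finally show "sqrt (\<Sum>i\<in>B j. p Z t i) * sqrt (\<Sum>i\<in>B j. p (sym_diff Z (B j)) t i)
          \<le> (s * b t j + 1 / s) / 2" by simp
    qed simp
    finally show ?thesis .
  qed
  have "real k = (\<Sum>j<k. 1)" by simp
  also have "\<dots> \<le> (\<Sum>j<k. real c * (\<Sum>t<T. (s * b t j + 1 / s) / 2))"
    by (rule sum_mono) (use one in auto)
  also have "\<dots> = real c * (\<Sum>t<T. \<Sum>j<k. (s * b t j + 1 / s) / 2)"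
    unfolding sum_distrib_left[symmetric] by (subst sum.swap) (rule refl)
  also have "\<dots> \<le> real c * (\<Sum>t<T. s)"
  proof (intro mult_left_mono sum_mono)
    fix t
    have "(\<Sum>j<k. (s * b t j + 1 / s) / 2) = (s * (\<Sum>j<k. b t j) + real k / s) / 2"
      by (simp add: sum.distrib sum_distrib_left flip: sum_divide_distrib)
    also have "\<dots> \<le> (s * 1 + s) / 2"
      using sumb[of t] s by (intro divide_right_mono add_mono mult_left_mono) (auto simp: field_simps)
    finally show "(\<Sum>j<k. (s * b t j + 1 / s) / 2) \<le> s" by simp
  qed simp
  finally have "s * s \<le> real (c * T) * s" using s by (simp add: mult.assoc)
  then have "s \<le> real (c * T)" using s(1) by (rule mult_right_le_imp_le)
  then have "s * s \<le> real (c * T) * real (c * T)" using s by (intro mult_mono) auto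
  then have "real k \<le> real ((c * T)\<^sup>2)" using s by (simp add: power2_eq_square)
  then show ?thesis by (simp only: of_nat_le_iff)
qed simp

text \<open>Compare \<open>F\<close> with parity on the subcube. A nonzero top coefficient means
  that agreement and disagreement are not equally frequent, so one of the two classes is more than
  half of the cube and carries an eigenvector \<open>v\<close>. Neighbours within a class differ in
  parity and hence in \<open>F\<close>. Thus \<open>sqrt (card M)\<close> times the squared norm of
  \<open>v\<close> is a sum over sensitive edges, each of which is bounded by
  \<open>distinguish\<close>.\<close>

lemma monomial_size_bound:
  assumes Z: "Z \<subseteq> {..<n}" and M: "M \<subseteq> {..<n}" and ne: "alt_sum F M Z \<noteq> 0"
  shows "card M \<le> (c * T)\<^sup>2"
proof (cases "M = {}")
  case False
  have finM: "finite M" using M finite_subset by blast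
  define X where "X S = (Z - M) \<union> S" for S
  define V where "V b = {S \<in> Pow M. (even (card S) = F (X S)) = b}" for b
  have compl: "Pow M - V b = V (\<not> b)" for b by (auto simp: V_def)
  have finV: "finite (V b)" for b using finM by (simp add: V_def)
  have "card (V True) \<noteq> card (V False)"
  proof
    assume eq: "card (V True) = card (V False)"
    \<comment> \<open>Doubling replaces the 0/1 values of \<open>F\<close> by signs, because the
      signs alone sum to 0. Each product of signs is then 1 on \<open>V True\<close> and -1 on
      \<open>V False\<close>.\<close>
    have "2 * alt_sum F M Z = (\<Sum>S\<in>Pow M. (-1) ^ card S * (2 * of_bool (F (X S)) - 1))"
      using sum_alternating_Pow[OF finM False]
      by (simp add: alt_sum_def X_def algebra_simps sum_subtractf flip: sum_distrib_left)
    also have "\<dots> = (\<Sum>S\<in>V True \<union> V False. if even (card S) = F (X S) then 1 else -1)"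
      by (rule sum.cong) (auto simp: V_def)
    also have "\<dots> = (\<Sum>S\<in>V True. if even (card S) = F (X S) then 1 else -1)
        + (\<Sum>S\<in>V False. if even (card S) = F (X S) then 1 else -1)"
      by (rule sum.union_disjoint[OF finV finV]) (auto simp: V_def)
    also have "\<dots> = (\<Sum>S\<in>V True. 1) + (\<Sum>S\<in>V False. -1)"
      by (intro arg_cong2[of _ _ _ _ "(+)"] sum.cong) (auto simp: V_def)
    finally show False using eq ne by simp
  qed
  then obtain b where b: "card (Pow M - V b) < card (V b)"
    using compl[of True] compl[of False] by (metis linorder_neq_iff)
  have "V b \<subseteq> Pow M" by (auto simp: V_def)
  from huang_eigenvector[OF finM False this b] obtain v S0 where
    S0: "S0 \<in> V b" "v S0 \<noteq> 0" and v0: "\<And>S. S \<in> Pow M - V b \<Longrightarrow> v S = 0"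
    and eig: "\<And>S. S \<in> Pow M \<Longrightarrow> huang M v S = sqrt (card M) * v S"
    by blast
  define N where "N = (\<Sum>S\<in>Pow M. (v S)\<^sup>2)"
  have N: "N > 0"
    unfolding N_def using S0 finM by (intro sum_pos2[of _ S0]) (auto simp: V_def)
  have edge: "\<bar>v S\<bar> * \<bar>v (flip i S)\<bar> \<le>
      real c * (\<Sum>t<T. ((v S)\<^sup>2 * p (X S) t i + (v (flip i S))\<^sup>2 * p (X (flip i S)) t i) / 2)"
    if S: "S \<in> Pow M" and i: "i \<in> M" for S i
  proof (cases "S \<in> V b \<and> flip i S \<in> V b")
    case True
    have finS: "finite S" using S finM finite_subset by auto
    have Fne: "F (X S) \<noteq> F (X (flip i S))"
      using True even_card_flip[OF finS, of i] by (auto simp: V_def)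
    have sub: "X S \<subseteq> {..<n}" "X (flip i S) \<subseteq> {..<n}"
      using Z M S flip_in_Pow[OF i S] by (auto simp: X_def)
    have sd: "sym_diff (X S) (X (flip i S)) = {i}"
      using S i by (auto simp: X_def flip_def)
    \<comment> \<open>The entries of \<open>v\<close> are distributed over the two square roots
      before the means are compared, so that each endpoint is charged its own weight times the
      square of its own entry.\<close>
    have "\<bar>v S\<bar> * \<bar>v (flip i S)\<bar> * 1 \<le> \<bar>v S\<bar> * \<bar>v (flip i S)\<bar> *
        (real c * (\<Sum>t<T. sqrt (p (X S) t i) * sqrt (p (X (flip i S)) t i)))"
      using distinguish[OF sub Fne] unfolding sd by (intro mult_left_mono) auto
    also have "\<dots> = real c * (\<Sum>t<T. (\<bar>v S\<bar> * sqrt (p (X S) t i)) *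
        (\<bar>v (flip i S)\<bar> * sqrt (p (X (flip i S)) t i)))"
      by (simp add: sum_distrib_left mult_ac)
    also have "\<dots> \<le> real c *
        (\<Sum>t<T. ((v S)\<^sup>2 * p (X S) t i + (v (flip i S))\<^sup>2 * p (X (flip i S)) t i) / 2)"
    proof (intro mult_left_mono sum_mono)
      fix t
      have amgm: "x * y \<le> (x\<^sup>2 + y\<^sup>2) / 2" for x y :: real
        using sum_squares_bound[of x y] by simp
      show "(\<bar>v S\<bar> * sqrt (p (X S) t i)) * (\<bar>v (flip i S)\<bar> * sqrt (p (X (flip i S)) t i))
        \<le> ((v S)\<^sup>2 * p (X S) t i + (v (flip i S))\<^sup>2 * p (X (flip i S)) t i) / 2"
        by (rule order_trans[OF amgm]) (simp add: power_mult_distrib weight_nonneg)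
    qed simp
    finally show ?thesis by simp
  next
    case False
    then have "\<bar>v S\<bar> * \<bar>v (flip i S)\<bar> = 0" using v0 S flip_in_Pow[OF i S] by auto
    moreover have "0 \<le> real c *
        (\<Sum>t<T. ((v S)\<^sup>2 * p (X S) t i + (v (flip i S))\<^sup>2 * p (X (flip i S)) t i) / 2)"
      by (intro mult_nonneg_nonneg sum_nonneg) (simp_all add: weight_nonneg)
    ultimately show ?thesis by linarith
  qed
  have "sqrt (card M) * N = (\<Sum>S\<in>Pow M. v S * huang M v S)"
    unfolding N_def by (simp add: eig sum_distrib_left power2_eq_square mult_ac)
  also have "\<dots> \<le> (\<Sum>S\<in>Pow M. \<Sum>i\<in>M. \<bar>v S\<bar> * \<bar>v (flip i S)\<bar>)"
  proof (rule sum_mono)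
    fix S
    have "v S * huang M v S = (\<Sum>i\<in>M. v S * (hsign i S * v (flip i S)))"
      by (simp add: huang_def sum_distrib_left)
    also have "\<dots> \<le> (\<Sum>i\<in>M. \<bar>v S\<bar> * \<bar>v (flip i S)\<bar>)"
      by (rule sum_mono, rule order_trans[OF abs_ge_self]) (simp add: abs_mult)
    finally show "v S * huang M v S \<le> (\<Sum>i\<in>M. \<bar>v S\<bar> * \<bar>v (flip i S)\<bar>)" .
  qed
  also have "\<dots> \<le> (\<Sum>S\<in>Pow M. \<Sum>i\<in>M. real c *
      (\<Sum>t<T. ((v S)\<^sup>2 * p (X S) t i + (v (flip i S))\<^sup>2 * p (X (flip i S)) t i) / 2))"
    by (intro sum_mono edge)
  also have "\<dots> = real c * (\<Sum>t<T. \<Sum>i\<in>M. \<Sum>S\<in>Pow M.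
      ((v S)\<^sup>2 * p (X S) t i + (v (flip i S))\<^sup>2 * p (X (flip i S)) t i) / 2)"
    unfolding sum_distrib_left[symmetric] by (subst sum_rotate3) (rule refl)
  also have "\<dots> = real c * (\<Sum>t<T. \<Sum>i\<in>M. \<Sum>S\<in>Pow M. (v S)\<^sup>2 * p (X S) t i)"
  proof -
    \<comment> \<open>Both endpoints of an edge are charged alike and \<open>flip i\<close> permutes
      the cube, so the two halves have equal sums.\<close>
    have "(\<Sum>S\<in>Pow M. ((v S)\<^sup>2 * p (X S) t i + (v (flip i S))\<^sup>2 * p (X (flip i S)) t i) / 2)
        = (\<Sum>S\<in>Pow M. (v S)\<^sup>2 * p (X S) t i)" if "i \<in> M" for t i
      using sum_flip[OF that, of "\<lambda>S. (v S)\<^sup>2 * p (X S) t i"]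
      by (simp add: sum.distrib flip: sum_divide_distrib)
    then show ?thesis by simp
  qed
  also have "\<dots> = real c * (\<Sum>t<T. \<Sum>S\<in>Pow M. (v S)\<^sup>2 * (\<Sum>i\<in>M. p (X S) t i))"
    unfolding sum_distrib_left[of "(v _)\<^sup>2"]
    by (intro arg_cong[of _ _ "(*) (real c)"] sum.cong refl sum.swap)
  also have "\<dots> \<le> real c * (\<Sum>t<T. N)"
    unfolding N_def
    by (intro mult_left_mono sum_mono mult_left_le weight_subset_le_1 M) auto
  finally have "sqrt (card M) * N \<le> real (c * T) * N" by (simp add: mult.assoc)
  then have "sqrt (card M) \<le> real (c * T)" using N by simp
  then have "(sqrt (card M))\<^sup>2 \<le> (real (c * T))\<^sup>2" by (intro power_mono) auto
  then have "real (card M) \<le> real ((c * T)\<^sup>2)" by simp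
  then show ?thesis by (simp only: of_nat_le_iff)
qed simp

text \<open>Midrijanis' decision tree: each round queries all variables of a maximal monomial
  of the function restricted by the answers so far.\<close>

definition pick :: "nat set \<Rightarrow> nat set \<Rightarrow> nat set" where
  "pick K P = (if \<exists>M. max_monomial n F K P M then SOME M. max_monomial n F K P M else {})"

text \<open>The variables queried in the first \<open>r\<close> rounds on input \<open>X\<close>.
  Each choice uses \<open>X\<close> only through its intersection with what is already known, so
  this is a legitimate adaptive strategy.\<close>

primrec known :: "nat \<Rightarrow> nat set \<Rightarrow> nat set" where
  "known 0 X = {}"
| "known (Suc r) X = known r X \<union> pick (known r X) (X \<inter> known r X)"

lemma max_monomial_pick:
  "max_monomial n F K P M \<Longrightarrow> max_monomial n F K P (pick K P)"
  unfolding pick_def by (metis someI)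

lemma pick_subset: "pick K P \<subseteq> {..<n} - K"
proof (cases "\<exists>M. max_monomial n F K P M")
  case True
  then show ?thesis using max_monomial_pick unfolding max_monomial_def by blast
qed (simp add: pick_def)

lemma known_mono: "r \<le> s \<Longrightarrow> known r X \<subseteq> known s X"
  by (rule lift_Suc_mono_le[of "\<lambda>r. known r X"]) auto

lemma card_pick:
  assumes X: "X \<subseteq> {..<n}"
  shows "card (pick K (X \<inter> K)) \<le> (c * T)\<^sup>2"
proof (cases "\<exists>M. max_monomial n F K (X \<inter> K) M")
  case True
  then have "max_monomial n F K (X \<inter> K) (pick K (X \<inter> K))"
    using max_monomial_pick by blast
  moreover have "X \<in> subcube n K (X \<inter> K)" using X by (simp add: subcube_def)
  ultimately have "alt_sum F (pick K (X \<inter> K)) X \<noteq> 0" by (auto simp: max_monomial_def)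
  then show ?thesis using monomial_size_bound[OF X] pick_subset by blast
qed (simp add: pick_def)

text \<open>The monomials picked along the way contain disjoint sensitive blocks of one and
  the same input, so block sensitivity bounds the number of rounds.\<close>

lemma known_constant:
  assumes X: "X \<subseteq> {..<n}" and Y: "Y \<subseteq> {..<n}"
    and agree: "Y \<inter> known ((c * T)\<^sup>2) X = X \<inter> known ((c * T)\<^sup>2) X"
  shows "F Y = F X"
proof (rule ccontr)
  assume ne: "F Y \<noteq> F X"
  define R where "R = (c * T)\<^sup>2"
  define M where "M r = pick (known r X) (X \<inter> known r X)" for r
  \<comment> \<open>\<open>known R X\<close> collects the picks of rounds 0 to \<open>R - 1\<close>.
    As \<open>F\<close> is still not constant afterwards, a further pick \<open>M R\<close> exists,
    and the \<open>R + 1\<close> blocks exceed the bound by one.\<close>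
  have block: "\<exists>B\<subseteq>M r. F (sym_diff X B) \<noteq> F X" if "r < Suc R" for r
  proof -
    have "known r X \<subseteq> known R X" using that by (intro known_mono) simp
    then have "Y \<inter> known r X = X \<inter> known r X" using agree unfolding R_def by blast
    then have "Y \<in> subcube n (known r X) (X \<inter> known r X)" using Y by (simp add: subcube_def)
    moreover have Xc: "X \<in> subcube n (known r X) (X \<inter> known r X)" using X by (simp add: subcube_def)
    ultimately have "max_monomial n F (known r X) (X \<inter> known r X) (M r)"
      unfolding M_def using max_monomial_exists ne max_monomial_pick by metis
    then have "M r \<noteq> {}" "alt_sum F (M r) X \<noteq> 0" "finite (M r)"
      using Xc by (auto simp: max_monomial_def intro: finite_subset)
    then show ?thesis using alt_sum_sensitive_block by blast
  qed
  define B where "B r = (SOME B. B \<subseteq> M r \<and> F (sym_diff X B) \<noteq> F X)" for r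
  have B: "B r \<subseteq> M r" "F (sym_diff X (B r)) \<noteq> F X" if "r < Suc R" for r
    using someI_ex[OF block[OF that, unfolded Bex_def Ball_def]] unfolding B_def by auto
  have later: "M r \<inter> M s = {}" if "r < s" for r s
  proof -
    have "M r \<subseteq> known (Suc r) X" by (simp add: M_def)
    also have "\<dots> \<subseteq> known s X" using that by (intro known_mono) simp
    finally show ?thesis using pick_subset[of "known s X" "X \<inter> known s X"] by (auto simp: M_def)
  qed
  have disj: "M r \<inter> M s = {}" if "r \<noteq> s" for r s
    using that later[of r s] later[of s r] by (cases "r < s") auto
  have Mn: "M r \<subseteq> {..<n}" for r using pick_subset unfolding M_def by blast
  have "Suc R \<le> (c * T)\<^sup>2"
  proof (rule block_sensitivity_bound[OF X, of _ B])
    fix i j assume "i < Suc R" "j < Suc R" "i \<noteq> j"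
    then show "B i \<inter> B j = {}" using B disj[of i j] by blast
  qed (use B Mn in blast)+
  then show False by (simp add: R_def)
qed

text \<open>Rounds are padded to \<open>(c * T)\<^sup>2\<close> queries by querying index 0. For \<open>c * T = 0\<close> nothing is ever
  picked and no query is made, so the junk values of \<open>div\<close> and \<open>mod\<close> are harmless.\<close>

definition query_index :: "nat \<Rightarrow> nat set \<Rightarrow> nat" where
  "query_index t X = (let d = (c * T)\<^sup>2; r = t div d;
     l = sorted_list_of_set (pick (known r X) (X \<inter> known r X))
   in if t mod d < length l then l ! (t mod d) else 0)"

lemma query_index_bound: "query_index t X < max 1 n"
proof -
  define l where "l = sorted_list_of_set
    (pick (known (t div (c * T)\<^sup>2) X) (X \<inter> known (t div (c * T)\<^sup>2) X))"
  have "set l \<subseteq> {..<n}"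
    unfolding l_def using pick_subset by (metis Diff_subset set_sorted_list_of_set subset_trans
      finite_subset finite_lessThan)
  then show ?thesis
    unfolding query_index_def Let_def l_def[symmetric] using nth_mem[of _ l] by fastforce
qed

lemma known_queried:
  assumes X: "X \<subseteq> {..<n}" and m: "m \<in> pick (known r X) (X \<inter> known r X)"
  shows "\<exists>s<Suc r * (c * T)\<^sup>2. r * (c * T)\<^sup>2 \<le> s \<and> query_index s X = m"
proof -
  define l where "l = sorted_list_of_set (pick (known r X) (X \<inter> known r X))"
  define d where "d = (c * T)\<^sup>2"
  have fin: "finite (pick (known r X) (X \<inter> known r X))"
    using pick_subset finite_subset by blast
  then have "m \<in> set l" using m by (simp add: l_def)
  then obtain j where j: "j < length l" "l ! j = m" by (auto simp: in_set_conv_nth)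
  have "length l \<le> d" using card_pick[OF X] by (simp add: l_def d_def)
  then have jd: "j < d" using j by simp
  then have "(r * d + j) div d = r" "(r * d + j) mod d = j" by auto
  then have "query_index (r * d + j) X = m"
    using j unfolding query_index_def Let_def d_def[symmetric] by (simp add: l_def)
  moreover have "r * d + j < Suc r * d" using jd by simp
  ultimately show ?thesis unfolding d_def[symmetric] by (metis le_add1)
qed

text \<open>As long as the answers agree, \<open>pick\<close> receives the same arguments on both
  inputs. The next round then asks for the same variables, and the equal answers carry the agreement
  one round further.\<close>

lemma known_determined:
  assumes X: "X \<subseteq> {..<n}"
    and "\<And>s. s < r * (c * T)\<^sup>2 \<Longrightarrow> (query_index s X \<in> X) = (query_index s Y \<in> Y)"
  shows "known r Y = known r X \<and> Y \<inter> known r X = X \<inter> known r X"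
  using assms(2)
proof (induction r)
  case (Suc r)
  have "known r Y = known r X \<and> Y \<inter> known r X = X \<inter> known r X"
    by (rule Suc.IH) (use Suc.prems in auto)
  then have IH: "known r Y = known r X" "Y \<inter> known r X = X \<inter> known r X" by auto
  define M where "M = pick (known r X) (X \<inter> known r X)"
  have idx: "query_index s Y = query_index s X" if "s div (c * T)\<^sup>2 = r" for s
    unfolding query_index_def Let_def that IH ..
  have "m \<in> Y \<longleftrightarrow> m \<in> X" if "m \<in> M" for m
  proof -
    from known_queried[OF X that[unfolded M_def]]
    obtain s where s: "s < Suc r * (c * T)\<^sup>2" "r * (c * T)\<^sup>2 \<le> s" "query_index s X = m" by blast
    then have "s div (c * T)\<^sup>2 = r"
      by (intro div_nat_eqI) (auto simp: mult.commute)
    from idx[OF this] Suc.prems[OF s(1)] s(3) show ?thesis by simp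
  qed
  then show ?case using IH by (auto simp: M_def)
qed simp

lemma query_index_determined:
  assumes X: "X \<subseteq> {..<n}"
    and agree: "\<And>s. s < t \<Longrightarrow> (query_index s X \<in> X) = (query_index s Y \<in> Y)"
  shows "query_index t X = query_index t Y"
proof -
  define r where "r = t div (c * T)\<^sup>2"
  have "r * (c * T)\<^sup>2 \<le> t" by (simp add: r_def)
  then have "known r Y = known r X \<and> Y \<inter> known r X = X \<inter> known r X"
    using agree by (intro known_determined[OF X]) auto
  then show ?thesis unfolding query_index_def Let_def r_def[symmetric] by simp
qed

text \<open>Only the positions queried on \<open>X\<close> are compared; the run on \<open>Y\<close>
  does not occur. Hence the answers seen on \<open>X\<close> form a certificate. The exponent 4
  stands for \<open>(c * T)^2\<close> rounds of \<open>(c * T)^2\<close> queries each.\<close>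

lemma queries_certify:
  assumes X: "X \<subseteq> {..<n}" and Y: "Y \<subseteq> {..<n}"
    and agree: "\<And>t. t < (c * T) ^ 4 \<Longrightarrow> (query_index t X \<in> Y) = (query_index t X \<in> X)"
  shows "F Y = F X"
proof (rule known_constant[OF X Y])
  have "m \<in> Y \<longleftrightarrow> m \<in> X" if "m \<in> known r X" "r \<le> (c * T)\<^sup>2" for m r
    using that
  proof (induction r)
    case (Suc r)
    show ?case
    proof (cases "m \<in> known r X")
      case True then show ?thesis using Suc by simp
    next
      case False
      then have "m \<in> pick (known r X) (X \<inter> known r X)" using Suc.prems by simp
      from known_queried[OF X this] obtain s where
        s: "s < Suc r * (c * T)\<^sup>2" "query_index s X = m" by blast
      have "Suc r * (c * T)\<^sup>2 \<le> (c * T)\<^sup>2 * (c * T)\<^sup>2"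
        using Suc.prems by (intro mult_right_mono) auto
      also have "\<dots> = (c * T) ^ 4" by (simp flip: power_add)
      finally show ?thesis using agree[of s] s by simp
    qed
  qed simp
  then show "Y \<inter> known ((c * T)\<^sup>2) X = X \<inter> known ((c * T)\<^sup>2) X" by blast
qed

end

section \<open>Diagonalization of Hermitian matrices\<close>

lemma mat_adjoint_carrier [simp]:
  "A \<in> carrier_mat n m \<Longrightarrow> mat_adjoint A \<in> carrier_mat m n"
  by (auto simp: mat_adjoint_def)

lemma dim_mat_adjoint [simp]:
  "dim_row (mat_adjoint A) = dim_col A" "dim_col (mat_adjoint A) = dim_row A"
  by (auto simp: mat_adjoint_def)

lemma mat_adjoint_index [simp]:
  fixes A :: "complex mat"
  assumes "i < dim_col A" "j < dim_row A"
  shows "mat_adjoint A $$ (i, j) = cnj (A $$ (j, i))"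
  using assms by (auto simp: mat_adjoint_def mat_of_rows_index)

lemma mat_adjoint_adjoint [simp]: "mat_adjoint (mat_adjoint A) = (A :: complex mat)"
  by (rule eq_matI) auto

lemma mat_adjoint_mult:
  fixes A B :: "complex mat"
  assumes "A \<in> carrier_mat n m" "B \<in> carrier_mat m l"
  shows "mat_adjoint (A * B) = mat_adjoint B * mat_adjoint A"
  by (rule eq_matI) (use assms in \<open>auto simp: scalar_prod_def mult.commute\<close>)

lemma unitary_mat_carrier: "unitary_mat n U \<Longrightarrow> U \<in> carrier_mat n n"
  by (simp add: unitary_mat_def)

lemma unitary_mat_adjoint: "unitary_mat n U \<Longrightarrow> unitary_mat n (mat_adjoint U)"
  by (auto simp: unitary_mat_def)

lemma unitary_mat_mult:
  assumes U: "unitary_mat n U" and V: "unitary_mat n V"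
  shows "unitary_mat n (U * V)"
proof -
  note [simp] = unitary_mat_carrier[OF U] unitary_mat_carrier[OF V]
  have adj: "mat_adjoint (U * V) = mat_adjoint V * mat_adjoint U"
    by (rule mat_adjoint_mult[of _ n n _ n]) auto
  have "(U * V) * (mat_adjoint V * mat_adjoint U) = U * (V * mat_adjoint V) * mat_adjoint U"
    by (simp add: assoc_mult_mat[of _ n n _ n _ n] mult_carrier_mat[of _ n n _ n])
  moreover have "(mat_adjoint V * mat_adjoint U) * (U * V) = mat_adjoint V * (mat_adjoint U * U) * V"
    by (simp add: assoc_mult_mat[of _ n n _ n _ n] mult_carrier_mat[of _ n n _ n])
  ultimately show ?thesis using U V unfolding unitary_mat_def adj
    by (simp add: right_mult_one_mat[of _ n n] mult_carrier_mat[of _ n n _ n])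
qed

lemma unitary_mat_one: "unitary_mat n (1\<^sub>m n)"
proof -
  have "mat_adjoint (1\<^sub>m n) = (1\<^sub>m n :: complex mat)" by (rule eq_matI) auto
  then show ?thesis by (simp add: unitary_mat_def)
qed

lemma cscalar_prod_adjoint:
  fixes A :: "complex mat"
  assumes "A \<in> carrier_mat n m" "u \<in> carrier_vec m" "v \<in> carrier_vec n"
  shows "(A *\<^sub>v u) \<bullet>c v = u \<bullet>c (mat_adjoint A *\<^sub>v v)"
proof -
  have "(A *\<^sub>v u) \<bullet>c v = (\<Sum>i<n. \<Sum>j<m. A $$ (i, j) * u $ j * cnj (v $ i))"
    using assms by (simp add: scalar_prod_def sum_distrib_right lessThan_atLeast0)
  also have "\<dots> = (\<Sum>j<m. \<Sum>i<n. A $$ (i, j) * u $ j * cnj (v $ i))" by (rule sum.swap)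
  also have "\<dots> = u \<bullet>c (mat_adjoint A *\<^sub>v v)"
    using assms by (simp add: scalar_prod_def sum_distrib_left lessThan_atLeast0 mult_ac)
  finally show ?thesis .
qed

lemma unitary_preserves_cscalar_prod:
  assumes U: "unitary_mat n U" and u: "u \<in> carrier_vec n" and v: "v \<in> carrier_vec n"
  shows "(U *\<^sub>v u) \<bullet>c (U *\<^sub>v v) = u \<bullet>c v"
proof -
  note c = unitary_mat_carrier[OF U]
  have "(U *\<^sub>v u) \<bullet>c (U *\<^sub>v v) = u \<bullet>c (mat_adjoint U *\<^sub>v (U *\<^sub>v v))"
    using c u v by (intro cscalar_prod_adjoint[of _ n n]) auto
  also have "mat_adjoint U *\<^sub>v (U *\<^sub>v v) = (mat_adjoint U * U) *\<^sub>v v"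
    using c v by (intro assoc_mult_mat_vec[symmetric, of _ n n _ n]) auto
  also have "\<dots> = v" using U v by (simp add: unitary_mat_def)
  finally show ?thesis .
qed

lemma cscalar_prod_self:
  "v \<bullet>c v = complex_of_real (\<Sum>i<dim_vec v. (cmod (v $ i))\<^sup>2)"
  unfolding scalar_prod_def of_real_sum lessThan_atLeast0
  by (rule sum.cong) (simp_all only: complex_norm_square dim_vec_conjugate, simp)

text \<open>The witness is a Householder reflection; if \<open>v\<close> is the first basis vector, then \<open>q = 0\<close> and the
  convention \<open>2 / 0 = 0\<close> makes it the identity.\<close>

lemma unitary_with_first_col:
  fixes v :: "complex vec"
  assumes v: "v \<in> carrier_vec (Suc m)" and norm: "v \<bullet>c v = 1" and real0: "cnj (v $ 0) = v $ 0"
  shows "\<exists>W. unitary_mat (Suc m) W \<and> mat_adjoint W = W \<and> W *\<^sub>v unit_vec (Suc m) 0 = v"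
proof -
  define u where "u i = v $ i - of_bool (i = 0)" for i
  define q where "q = (\<Sum>k<Suc m. cnj (u k) * u k)"
  define \<beta> where "\<beta> = 2 / q"
  define W where "W = mat (Suc m) (Suc m) (\<lambda>(i, j). of_bool (i = j) - \<beta> * u i * cnj (u j))"
  have nv: "(\<Sum>k<Suc m. v $ k * cnj (v $ k)) = 1"
    using norm v by (simp add: scalar_prod_def lessThan_atLeast0 del: sum.op_ivl_Suc)
  \<comment> \<open>Here norm 1 and the real first coordinate enter. They also give
    \<open>cnj (u 0) = - (q / 2)\<close> below, so the reflection adds exactly \<open>u\<close> to
    the first basis vector.\<close>
  have q: "q = 2 - 2 * v $ 0"
  proof -
    have "q = (\<Sum>k<Suc m. v $ k * cnj (v $ k) - (if k = 0 then v $ 0 + cnj (v $ 0) - 1 else 0))"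
      unfolding q_def u_def by (rule sum.cong) (auto simp: algebra_simps)
    also have "\<dots> = 1 - (v $ 0 + cnj (v $ 0) - 1)"
      unfolding sum_subtractf nv by (simp del: sum.lessThan_Suc)
    finally show ?thesis using real0 by simp
  qed
  have cq: "cnj q = q" unfolding q using real0 by simp
  have q0: "u k = 0" if "q = 0" "k < Suc m" for k
  proof -
    have "q = complex_of_real (\<Sum>k<Suc m. (cmod (u k))\<^sup>2)"
      unfolding q_def of_real_sum by (rule sum.cong) (auto simp: complex_norm_square[unfolded of_real_power] mult.commute)
    then have "(\<Sum>k<Suc m. (cmod (u k))\<^sup>2) = 0" using that by (metis of_real_eq_0_iff)
    then have "(cmod (u k))\<^sup>2 = 0" using that(2) by (subst (asm) sum_nonneg_eq_0_iff) auto
    then show ?thesis by simp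
  qed
  have Wc: "W \<in> carrier_mat (Suc m) (Suc m)" by (simp add: W_def)
  have adj: "mat_adjoint W = W"
    by (rule eq_matI) (auto simp: W_def \<beta>_def cq)
  have "W * W = 1\<^sub>m (Suc m)"
  proof (rule eq_matI)
    fix i j assume "i < dim_row (1\<^sub>m (Suc m) :: complex mat)" "j < dim_col (1\<^sub>m (Suc m) :: complex mat)"
    then have ij: "i < Suc m" "j < Suc m" by auto
    have "(W * W) $$ (i, j) = (\<Sum>k<Suc m. (of_bool (i = k) - \<beta> * u i * cnj (u k)) * (of_bool (k = j) - \<beta> * u k * cnj (u j)))"
      using ij by (simp add: W_def scalar_prod_def lessThan_atLeast0 del: sum.op_ivl_Suc)
    also have "\<dots> = (\<Sum>k<Suc m. (if k = i then of_bool (i = j) - \<beta> * u i * cnj (u j) else 0)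
        - (if k = j then \<beta> * u i * cnj (u j) else 0)
        + \<beta> * \<beta> * u i * cnj (u j) * (cnj (u k) * u k))"
      by (rule sum.cong) (auto simp: algebra_simps)
    also have "\<dots> = of_bool (i = j) - 2 * \<beta> * u i * cnj (u j) + \<beta> * \<beta> * u i * cnj (u j) * q"
      unfolding sum.distrib sum_subtractf q_def sum_distrib_left[symmetric]
      using ij by (simp del: sum.lessThan_Suc)
    also have "\<dots> = of_bool (i = j)"
      by (cases "q = 0") (simp_all add: \<beta>_def field_simps)
    finally show "(W * W) $$ (i, j) = 1\<^sub>m (Suc m) $$ (i, j)" using ij by simp
  qed (auto simp: W_def)
  then have uni: "unitary_mat (Suc m) W" using Wc by (simp add: unitary_mat_def adj)
  have "W *\<^sub>v unit_vec (Suc m) 0 = v"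
  proof (rule eq_vecI)
    fix i assume "i < dim_vec v"
    then have i: "i < Suc m" using v by simp
    have "(W *\<^sub>v unit_vec (Suc m) 0) $ i = of_bool (i = 0) - \<beta> * u i * cnj (u 0)"
      using i by (simp add: W_def)
    also have "cnj (u 0) = - (q / 2)" unfolding q u_def using real0 by (simp add: field_simps)
    also have "of_bool (i = 0) - \<beta> * u i * (- (q / 2)) = of_bool (i = 0) + u i"
      using q0[OF _ i] by (cases "q = 0") (auto simp: \<beta>_def)
    finally show "(W *\<^sub>v unit_vec (Suc m) 0) $ i = v $ i" by (simp add: u_def)
  qed (use v in \<open>auto simp: W_def\<close>)
  with uni adj show ?thesis by blast
qed

text \<open>Deflation: a reflection \<open>W\<close> carries the first basis vector to a unit
  eigenvector, so the first column of \<open>W * A * W\<close> is a multiple of that basis vector.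
  By symmetry so is the first row, and the remaining block is Hermitian of size one less.\<close>

lemma hermitian_unitary_diagonalization:
  fixes A :: "complex mat"
  assumes "A \<in> carrier_mat n n" "mat_adjoint A = A"
  shows "\<exists>U d. unitary_mat n U \<and> A = U * mat_diag n (\<lambda>i. complex_of_real (d i)) * mat_adjoint U"
  using assms
proof (induction n arbitrary: A)
  case 0
  show ?case
    by (rule exI[of _ "1\<^sub>m 0"], rule exI[of _ "\<lambda>_. 0"]) (use 0 unitary_mat_one[of 0] in \<open>auto intro!: eq_matI\<close>)
next
  case (Suc m)
  let ?n = "Suc m"
  note [simp] = Suc.prems(1)
  from spectrum_non_empty[OF Suc.prems(1)] obtain e v where ev: "eigenvector A v e"
    by (auto simp: spectrum_def eigenvalue_def)
  then have vc: "v \<in> carrier_vec ?n" and v0: "v \<noteq> 0\<^sub>v ?n" and Av: "A *\<^sub>v v = e \<cdot>\<^sub>v v"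
    using carrier_matD[OF Suc.prems(1)] by (auto simp: eigenvector_def simp del: Suc.prems)
  define s where "s = (\<Sum>i<?n. (cmod (v $ i))\<^sup>2)"
  have vv: "v \<bullet>c v = complex_of_real s" using vc by (simp only: cscalar_prod_self s_def carrier_vecD)
  have "v \<bullet>c v \<noteq> 0" using vc v0 by simp
  then have "s \<noteq> 0" using vv by auto
  moreover have "s \<ge> 0" unfolding s_def by (intro sum_nonneg) auto
  ultimately have s: "s > 0" by simp
  \<comment> \<open>Besides normalizing, the factor turns the phase of \<open>v\<close> so that its
    first coordinate becomes real, as the reflection requires.\<close>
  define \<alpha> where "\<alpha> = (if v $ 0 = 0 then 1 else cnj (v $ 0) / cmod (v $ 0)) / complex_of_real (sqrt s)"
  define v' where "v' = \<alpha> \<cdot>\<^sub>v v"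
  have v'c: "v' \<in> carrier_vec ?n" using vc by (simp add: v'_def)
  have "cmod (if v $ 0 = 0 then 1 else cnj (v $ 0) / cmod (v $ 0)) = 1" by (simp add: norm_divide)
  then have "\<alpha> * cnj \<alpha> = complex_of_real (1 / s)"
    using s unfolding complex_norm_square[symmetric] \<alpha>_def norm_divide
    by (simp add: power_divide flip: of_real_power)
  then have n1: "v' \<bullet>c v' = 1"
    unfolding v'_def using vc s vv
    by (simp add: conjugate_smult_vec mult.assoc[symmetric] mult.commute[of "cnj \<alpha>"])
  have r0: "cnj (v' $ 0) = v' $ 0"
    using vc by (simp add: v'_def \<alpha>_def mult.commute)
  from unitary_with_first_col[OF v'c n1 r0] obtain W where
    W: "unitary_mat ?n W" "mat_adjoint W = W" "W *\<^sub>v unit_vec ?n 0 = v'" by blast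
  note [simp] = unitary_mat_carrier[OF W(1)]
  have WW: "W * W = 1\<^sub>m ?n" using W by (simp add: unitary_mat_def)
  define A' where "A' = W * A * W"
  have A'c [simp]: "A' \<in> carrier_mat ?n ?n"
    unfolding A'_def by (rule mult_carrier_mat[of _ _ ?n] | simp)+
  have A'h: "mat_adjoint A' = A'"
    unfolding A'_def
    by (simp add: mat_adjoint_mult[of _ ?n ?n _ ?n] Suc.prems W assoc_mult_mat[of _ ?n ?n _ ?n _ ?n] mult_carrier_mat[of _ ?n ?n _ ?n])
  have WA'W: "W * A' * W = A"
  proof -
    have "W * A' * W = (W * W) * A * (W * W)"
      unfolding A'_def by (simp add: assoc_mult_mat[of _ ?n ?n _ ?n _ ?n] mult_carrier_mat[of _ ?n ?n _ ?n])
    then show ?thesis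
      by (simp add: WW right_mult_one_mat[of _ ?n ?n] left_mult_one_mat[of _ ?n ?n])
  qed
  have "A' *\<^sub>v unit_vec ?n 0 = W *\<^sub>v (A *\<^sub>v (W *\<^sub>v unit_vec ?n 0))"
    unfolding A'_def by (simp add: assoc_mult_mat_vec[of _ ?n ?n _ ?n] assoc_mult_mat[of _ ?n ?n _ ?n _ ?n] mult_carrier_mat[of _ ?n ?n _ ?n])
  also have "\<dots> = W *\<^sub>v (e \<cdot>\<^sub>v v')"
    unfolding W v'_def using vc Av by (simp add: mult_mat_vec[of _ ?n ?n] smult_smult_assoc mult.commute)
  also have "\<dots> = e \<cdot>\<^sub>v (W *\<^sub>v (W *\<^sub>v unit_vec ?n 0))"
    unfolding W using v'c by (simp add: mult_mat_vec[of _ ?n ?n])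
  also have "W *\<^sub>v (W *\<^sub>v unit_vec ?n 0) = unit_vec ?n 0"
    by (simp add: assoc_mult_mat_vec[symmetric, of _ ?n ?n _ ?n] WW one_mult_mat_vec[of _ ?n])
  finally have col: "A' *\<^sub>v unit_vec ?n 0 = e \<cdot>\<^sub>v unit_vec ?n 0" .
  have Ai0: "A' $$ (i, 0) = (if i = 0 then e else 0)" if "i < ?n" for i
  proof -
    have "(A' *\<^sub>v unit_vec ?n 0) $ i = A' $$ (i, 0)"
      using that A'c by (simp del: A'c)
    then show ?thesis using col that by (auto split: if_splits)
  qed
  have herm: "A' $$ (i, j) = cnj (A' $$ (j, i))" if "i < ?n" "j < ?n" for i j
    using that A'h A'c mat_adjoint_index[of i A' j] by (simp del: A'c)
  have A0j: "A' $$ (0, j) = (if j = 0 then e else 0)" if "j < ?n" for j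
    using herm[of 0 j] Ai0[of j] Ai0[of 0] that by auto
  have e_real: "cnj e = e" using herm[of 0 0] Ai0[of 0] by simp
  define A3 where "A3 = mat m m (\<lambda>(i, j). A' $$ (Suc i, Suc j))"
  have A3h: "mat_adjoint A3 = A3"
    by (rule eq_matI) (auto simp: A3_def herm[symmetric])
  have A3c: "A3 \<in> carrier_mat m m" by (simp add: A3_def)
  from Suc.IH[OF A3c A3h] obtain U3 d where U3: "unitary_mat m U3"
    and A3: "A3 = U3 * mat_diag m (\<lambda>i. complex_of_real (d i)) * mat_adjoint U3"
    by blast
  note U3c [simp] = unitary_mat_carrier[OF U3]
  define blk where "blk a B = four_block_mat (mat 1 1 (\<lambda>_. a)) (0\<^sub>m 1 m) (0\<^sub>m m 1) B" for a :: complex and B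
  have blk_c [simp]: "blk a B \<in> carrier_mat ?n ?n" if "B \<in> carrier_mat m m" for a B
    unfolding blk_def using four_block_carrier_mat[of "mat 1 1 (\<lambda>_. a)" 1 1 B m m] that by simp
  have blk_mult: "blk a B * blk b C = blk (a * b) (B * C)"
    if "B \<in> carrier_mat m m" "C \<in> carrier_mat m m" for a b B C
  proof -
    have "mat 1 1 (\<lambda>_. a) * mat 1 1 (\<lambda>_. b) = mat 1 1 (\<lambda>_. a * b)"
      by (rule eq_matI) (auto simp: scalar_prod_def)
    then show ?thesis
      unfolding blk_def using that
      by (subst mult_four_block_mat[of _ 1 1 _ m _ m _ _ 1 _ m]) auto
  qed
  have blk_adj: "mat_adjoint (blk a B) = blk (cnj a) (mat_adjoint B)" if "B \<in> carrier_mat m m" for a B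
    by (rule eq_matI) (use that in \<open>auto simp: blk_def\<close>)
  have blk_one: "blk 1 (1\<^sub>m m) = 1\<^sub>m ?n"
    by (rule eq_matI) (auto simp: blk_def)
  define F where "F = blk 1 U3"
  have F: "unitary_mat ?n F"
    using U3 unfolding unitary_mat_def F_def by (simp add: blk_mult blk_adj blk_one)
  define d' where "d' i = (case i of 0 \<Rightarrow> Re e | Suc k \<Rightarrow> d k)" for i
  have D: "mat_diag ?n (\<lambda>i. complex_of_real (d' i)) = blk e (mat_diag m (\<lambda>i. complex_of_real (d i)))"
    using e_real
    by (intro eq_matI) (auto simp: blk_def mat_diag_def d'_def complex_eq_iff split: nat.split)
  have A'_blk: "A' = blk e A3"
    by (rule eq_matI) (use A'c A3c in \<open>auto simp: blk_def A3_def Ai0 A0j simp del: A'c\<close>)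
  have dc [simp]: "mat_diag k g \<in> carrier_mat k k" for k and g :: "nat \<Rightarrow> complex" by simp
  have "F * mat_diag ?n (\<lambda>i. complex_of_real (d' i)) * mat_adjoint F = A'"
    unfolding A'_blk D F_def A3 by (simp add: blk_mult blk_adj mult_carrier_mat[of _ m m])
  then have "A = W * (F * mat_diag ?n (\<lambda>i. complex_of_real (d' i)) * mat_adjoint F) * W"
    using WA'W by simp
  also have "\<dots> = (W * F) * mat_diag ?n (\<lambda>i. complex_of_real (d' i)) * mat_adjoint (W * F)"
    using unitary_mat_carrier[OF F]
    by (simp add: mat_adjoint_mult[of _ ?n ?n _ ?n] W assoc_mult_mat[of _ ?n ?n _ ?n _ ?n] mult_carrier_mat[of _ ?n ?n _ ?n])
  finally show ?case using unitary_mat_mult[OF W(1) F] by blast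
qed

section \<open>Trace norm and partial trace\<close>

definition mat_tr :: "complex mat \<Rightarrow> complex" where
  "mat_tr A = (\<Sum>i<dim_row A. A $$ (i, i))"

lemma mat_tr_mult:
  assumes "A \<in> carrier_mat n n" "B \<in> carrier_mat n n"
  shows "mat_tr (A * B) = (\<Sum>i<n. \<Sum>j<n. A $$ (i, j) * B $$ (j, i))"
  using assms by (simp add: mat_tr_def scalar_prod_def lessThan_atLeast0)

lemma mat_tr_commute:
  assumes "A \<in> carrier_mat n n" "B \<in> carrier_mat n n"
  shows "mat_tr (A * B) = mat_tr (B * A)"
  unfolding mat_tr_mult[OF assms] mat_tr_mult[OF assms(2,1)]
  by (subst sum.swap) (simp add: mult.commute)

text \<open>\<open>trace_norm\<close> selects an arbitrary value, so a singular value decomposition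
  has to be exhibited first. For a Hermitian matrix it comes from the diagonalization by moving the
  signs of the eigenvalues into the right unitary factor.\<close>

lemma trace_norm_svd:
  assumes A: "A \<in> carrier_mat n n" "mat_adjoint A = A"
  shows "\<exists>U V s. unitary_mat n U \<and> unitary_mat n V \<and> (\<forall>i<n. s i \<ge> 0) \<and>
    A = U * mat_diag n (\<lambda>i. complex_of_real (s i)) * mat_adjoint V \<and> trace_norm n A = (\<Sum>i<n. s i)"
proof -
  from hermitian_unitary_diagonalization[OF A] obtain U d where U: "unitary_mat n U"
    and AU: "A = U * mat_diag n (\<lambda>i. complex_of_real (d i)) * mat_adjoint U" by blast
  note Uc = unitary_mat_carrier[OF U]
  \<comment> \<open>The eigenvalue 0 gets sign 1, not 0, which keeps \<open>G\<close>
    unitary.\<close>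
  define \<sigma> where "\<sigma> i = (if d i < 0 then - 1 else 1 :: complex)" for i
  define G where "G = mat_diag n \<sigma>"
  have Gc: "G \<in> carrier_mat n n" by (simp add: G_def)
  have Gadj: "mat_adjoint G = G"
    by (rule eq_matI) (auto simp: G_def mat_diag_def \<sigma>_def)
  have "G * G = mat_diag n (\<lambda>i. 1)"
    unfolding G_def mat_diag_diag by (rule arg_cong[of _ _ "mat_diag n"]) (auto simp: \<sigma>_def)
  then have "unitary_mat n G" using Gc by (simp add: unitary_mat_def Gadj)
  then have V: "unitary_mat n (U * G)" using U by (simp add: unitary_mat_mult)
  have "mat_diag n (\<lambda>i. complex_of_real \<bar>d i\<bar>) * G = mat_diag n (\<lambda>i. complex_of_real (d i))"
    unfolding G_def mat_diag_diag by (rule arg_cong[of _ _ "mat_diag n"]) (auto simp: \<sigma>_def)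
  then have "A = U * (mat_diag n (\<lambda>i. complex_of_real \<bar>d i\<bar>) * G) * mat_adjoint U"
    using AU by simp
  also have "\<dots> = U * mat_diag n (\<lambda>i. complex_of_real \<bar>d i\<bar>) * mat_adjoint (U * G)"
    using Uc Gc by (simp add: mat_adjoint_mult[of _ n n _ n] Gadj
        assoc_mult_mat[of _ n n _ n _ n] mult_carrier_mat[of _ n n _ n])
  finally have "\<exists>t U V s. unitary_mat n U \<and> unitary_mat n V \<and> (\<forall>i<n. s i \<ge> 0) \<and>
      A = U * mat_diag n (\<lambda>i. complex_of_real (s i)) * mat_adjoint V \<and> t = (\<Sum>i<n. s i)"
    using U V by (intro exI[of _ "\<Sum>i<n. \<bar>d i\<bar>"] exI[of _ U] exI[of _ "U * G"] exI[of _ "\<lambda>i. \<bar>d i\<bar>"]) auto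
  from someI_ex[OF this] show ?thesis unfolding trace_norm_def .
qed

text \<open>With \<open>mat_tr_le_trace_norm\<close> this identifies the selected value, for
  Hermitian \<open>A\<close>, as the maximum of \<open>cmod (mat_tr (A * W))\<close> over unitary
  \<open>W\<close>. The witness \<open>V * mat_adjoint U\<close> cancels both outer factors.\<close>

lemma trace_norm_attained:
  assumes A: "A \<in> carrier_mat n n" "mat_adjoint A = A"
  shows "\<exists>W. unitary_mat n W \<and> complex_of_real (trace_norm n A) = mat_tr (A * W)"
proof -
  from trace_norm_svd[OF A] obtain U V s where U: "unitary_mat n U" and V: "unitary_mat n V"
    and AU: "A = U * mat_diag n (\<lambda>i. complex_of_real (s i)) * mat_adjoint V"
    and t: "trace_norm n A = (\<Sum>i<n. s i)" by blast
  define D where "D = mat_diag n (\<lambda>i. complex_of_real (s i))"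
  have c: "U \<in> carrier_mat n n" "V \<in> carrier_mat n n" "D \<in> carrier_mat n n"
    using U V by (auto simp: unitary_mat_carrier D_def)
  have "A * (V * mat_adjoint U) = U * (D * (mat_adjoint V * V)) * mat_adjoint U"
    unfolding AU D_def[symmetric] using c
    by (simp add: assoc_mult_mat[of _ n n _ n _ n] mult_carrier_mat[of _ n n _ n])
  also have "\<dots> = U * D * mat_adjoint U"
    using V c by (simp add: unitary_mat_def right_mult_one_mat[of _ n n])
  finally have "mat_tr (A * (V * mat_adjoint U)) = mat_tr (mat_adjoint U * (U * D))"
    using c by (simp add: mat_tr_commute[of _ n] mult_carrier_mat[of _ n n _ n])
  also have "mat_adjoint U * (U * D) = (mat_adjoint U * U) * D"
    using c by (simp add: assoc_mult_mat[of _ n n _ n _ n])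
  also have "\<dots> = D" using U c by (simp add: unitary_mat_def left_mult_one_mat[of _ n n])
  also have "mat_tr D = complex_of_real (trace_norm n A)"
    by (simp add: mat_tr_def D_def mat_diag_def t)
  finally show ?thesis
    using unitary_mat_mult[OF V unitary_mat_adjoint[OF U]] by metis
qed

lemma unitary_entry_le_1:
  assumes U: "unitary_mat n U" and ij: "i < n" "j < n"
  shows "cmod (U $$ (i, j)) \<le> 1"
proof -
  have "(U * mat_adjoint U) $$ (i, i) = 1" using U ij by (simp add: unitary_mat_def)
  then have "complex_of_real (\<Sum>k<n. (cmod (U $$ (i, k)))\<^sup>2) = 1"
    using unitary_mat_carrier[OF U] ij
    by (simp add: scalar_prod_def lessThan_atLeast0 complex_norm_square[unfolded of_real_power])
  then have "(\<Sum>k<n. (cmod (U $$ (i, k)))\<^sup>2) = 1" by (metis of_real_eq_1_iff)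
  moreover have "(cmod (U $$ (i, j)))\<^sup>2 \<le> (\<Sum>k<n. (cmod (U $$ (i, k)))\<^sup>2)"
    using ij by (intro member_le_sum) auto
  ultimately show ?thesis by (simp add: power_le_one_iff abs_square_le_1)
qed

text \<open>By cyclicity the trace is that of the singular values times a unitary matrix
  \<open>X\<close>, whose diagonal entries have modulus at most 1.\<close>

lemma mat_tr_le_trace_norm:
  assumes A: "A \<in> carrier_mat n n" "mat_adjoint A = A" and W: "unitary_mat n W"
  shows "cmod (mat_tr (A * W)) \<le> trace_norm n A"
proof -
  from trace_norm_svd[OF A] obtain U V s where U: "unitary_mat n U" and V: "unitary_mat n V"
    and s: "\<And>i. i < n \<Longrightarrow> s i \<ge> 0"
    and AU: "A = U * mat_diag n (\<lambda>i. complex_of_real (s i)) * mat_adjoint V"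
    and t: "trace_norm n A = (\<Sum>i<n. s i)" by blast
  define D where "D = mat_diag n (\<lambda>i. complex_of_real (s i))"
  have c: "U \<in> carrier_mat n n" "V \<in> carrier_mat n n" "D \<in> carrier_mat n n" "W \<in> carrier_mat n n"
    using U V W by (auto simp: unitary_mat_carrier D_def)
  define X where "X = mat_adjoint V * W * U"
  have X: "unitary_mat n X"
    unfolding X_def by (intro unitary_mat_mult unitary_mat_adjoint U V W)
  have "A * W = U * (D * mat_adjoint V * W)"
    unfolding AU D_def[symmetric] using c
    by (simp add: assoc_mult_mat[of _ n n _ n _ n] mult_carrier_mat[of _ n n _ n])
  then have "mat_tr (A * W) = mat_tr (D * mat_adjoint V * W * U)"
    using c by (simp add: mat_tr_commute[of U n] mult_carrier_mat[of _ n n _ n])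
  also have "D * mat_adjoint V * W * U = D * X"
    unfolding X_def using c
    by (simp add: assoc_mult_mat[of _ n n _ n _ n] mult_carrier_mat[of _ n n _ n])
  also have "mat_tr (D * X) = (\<Sum>i<n. s i * X $$ (i, i))"
    using unitary_mat_carrier[OF X] unfolding D_def
    by (simp add: mat_diag_mult_left[of _ n n] mat_tr_def)
  also have "cmod \<dots> \<le> (\<Sum>i<n. s i * 1)"
    by (rule order_trans[OF norm_sum], rule sum_mono)
      (auto simp: norm_mult s intro!: mult_left_le unitary_entry_le_1[OF X])
  finally show ?thesis by (simp add: t)
qed

section \<open>Euclidean norm and quadratic forms\<close>

definition vnorm :: "complex vec \<Rightarrow> real" where
  "vnorm v = L2_set (\<lambda>k. cmod (v $ k)) {..<dim_vec v}"

lemma vnorm_nonneg [simp]: "0 \<le> vnorm v"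
  by (simp add: vnorm_def L2_set_nonneg)

lemma vnorm_sq: "(vnorm v)\<^sup>2 = (\<Sum>k<dim_vec v. (cmod (v $ k))\<^sup>2)"
  by (simp add: vnorm_def L2_set_def sum_nonneg)

lemma cscalar_prod_vnorm: "v \<bullet>c v = complex_of_real ((vnorm v)\<^sup>2)"
  unfolding vnorm_sq by (rule cscalar_prod_self)

lemma cauchy_schwarz_vec:
  assumes "dim_vec u = dim_vec v"
  shows "cmod (u \<bullet>c v) \<le> vnorm u * vnorm v"
proof -
  have "cmod (u \<bullet>c v) \<le> (\<Sum>k<dim_vec v. \<bar>cmod (u $ k)\<bar> * \<bar>cmod (v $ k)\<bar>)"
    unfolding scalar_prod_def lessThan_atLeast0 dim_vec_conjugate
    by (rule order_trans[OF norm_sum], rule sum_mono) (simp add: norm_mult)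
  also have "\<dots> \<le> vnorm u * vnorm v"
    unfolding vnorm_def assms by (rule L2_set_mult_ineq)
  finally show ?thesis .
qed

lemma unitary_vnorm:
  assumes U: "unitary_mat n U" and v: "v \<in> carrier_vec n"
  shows "vnorm (U *\<^sub>v v) = vnorm v"
proof -
  have "complex_of_real ((vnorm (U *\<^sub>v v))\<^sup>2) = complex_of_real ((vnorm v)\<^sup>2)"
    using unitary_preserves_cscalar_prod[OF U v v] by (simp only: cscalar_prod_vnorm)
  then have "(vnorm (U *\<^sub>v v))\<^sup>2 = (vnorm v)\<^sup>2" by (simp only: of_real_eq_iff)
  then show ?thesis by (simp add: power2_eq_iff_nonneg)
qed

text \<open>The two arguments of the form are exchanged one at a time. This controls the distance of
  the rank-one states of \<open>a\<close> and \<open>b\<close>, tested against a unitary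
  \<open>W\<close>.\<close>

lemma quadratic_form_diff:
  assumes W: "unitary_mat n W" and a: "a \<in> carrier_vec n" and b: "b \<in> carrier_vec n"
  shows "cmod ((W *\<^sub>v a) \<bullet>c a - (W *\<^sub>v b) \<bullet>c b) \<le> vnorm (a - b) * vnorm a + vnorm (a - b) * vnorm b"
proof -
  note Wc = unitary_mat_carrier[OF W]
  have Wa: "W *\<^sub>v a \<in> carrier_vec n" "W *\<^sub>v b \<in> carrier_vec n" using Wc a b by auto
  have "(W *\<^sub>v (a - b)) \<bullet>c a = (W *\<^sub>v a) \<bullet>c a - (W *\<^sub>v b) \<bullet>c a"
    using Wc Wa a b by (simp add: mult_minus_distrib_mat_vec[of _ n n] minus_scalar_prod_distrib[of _ n])
  moreover have "(W *\<^sub>v b) \<bullet>c (a - b) = (W *\<^sub>v b) \<bullet>c a - (W *\<^sub>v b) \<bullet>c b"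
    using Wc Wa a b by (simp add: scalar_prod_def sum_subtractf algebra_simps)
  ultimately have "(W *\<^sub>v a) \<bullet>c a - (W *\<^sub>v b) \<bullet>c b = (W *\<^sub>v (a - b)) \<bullet>c a + (W *\<^sub>v b) \<bullet>c (a - b)"
    by simp
  also have "cmod \<dots> \<le> vnorm (W *\<^sub>v (a - b)) * vnorm a + vnorm (W *\<^sub>v b) * vnorm (a - b)"
    by (rule order_trans[OF norm_triangle_ineq], intro add_mono cauchy_schwarz_vec)
      (use Wc a b in auto)
  also have "\<dots> = vnorm (a - b) * vnorm a + vnorm (a - b) * vnorm b"
    using a b by (simp add: unitary_vnorm[OF W])
  finally show ?thesis .
qed

lemma nat_less_power2_iff_bits: "(k :: nat) < 2 ^ m \<longleftrightarrow> (\<forall>p\<ge>m. \<not> bit k p)"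
proof
  assume "k < 2 ^ m"
  then have "take_bit m k = k" by (simp add: take_bit_nat_eq_self_iff)
  then show "\<forall>p\<ge>m. \<not> bit k p" by (metis bit_take_bit_iff not_less)
next
  assume "\<forall>p\<ge>m. \<not> bit k p"
  then have "take_bit m k = k" by (intro bit_eqI) (auto simp: bit_take_bit_iff simp flip: not_less)
  then show "k < 2 ^ m" by (simp add: take_bit_nat_eq_self_iff)
qed

lemma nat_with_bits_exists: "finite S \<Longrightarrow> \<exists>k :: nat. \<forall>p. bit k p \<longleftrightarrow> p \<in> S"
proof (induction S rule: finite_induct)
  case empty
  show ?case by (rule exI[of _ 0]) simp
next
  case (insert q S)
  then obtain k :: nat where "\<forall>p. bit k p \<longleftrightarrow> p \<in> S" by blast
  then show ?case by (intro exI[of _ "set_bit q k"]) (auto simp: bit_set_bit_iff)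
qed

text \<open>Every label is in exactly one way the \<open>or\<close> of a part \<open>s\<close>
  within the positions \<open>S\<close> and a part \<open>k\<close> outside. Masking with
  \<open>\<mu>\<close>, whose bits are exactly \<open>S\<close>, recovers the parts.\<close>

lemma sum_split_bits:
  fixes g :: "nat \<Rightarrow> 'a :: comm_monoid_add"
  assumes S: "finite S"
  shows "(\<Sum>s\<in>{s. s < 2 ^ m \<and> (\<forall>p. bit s p \<longrightarrow> p \<in> S)}.
      \<Sum>k<2 ^ m. if \<forall>p\<in>S. \<not> bit k p then g (or k s) else 0) = (\<Sum>k<2 ^ m. g k)"
proof -
  let ?A = "{s::nat. s < 2 ^ m \<and> (\<forall>p. bit s p \<longrightarrow> p \<in> S)}"
  let ?B = "{k::nat. k < 2 ^ m \<and> (\<forall>p\<in>S. \<not> bit k p)}"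
  obtain \<mu> :: nat where \<mu>: "\<And>p. bit \<mu> p \<longleftrightarrow> p \<in> S" using nat_with_bits_exists[OF S] by blast
  have "(\<Sum>k<2 ^ m. if \<forall>p\<in>S. \<not> bit k p then g (or k s) else 0) = (\<Sum>k\<in>?B. g (or k s))" for s
    by (rule sum.mono_neutral_cong_right) auto
  then have "(\<Sum>s\<in>?A. \<Sum>k<2 ^ m. if \<forall>p\<in>S. \<not> bit k p then g (or k s) else 0)
      = (\<Sum>(s, k)\<in>?A \<times> ?B. g (or k s))"
    by (simp add: sum.cartesian_product)
  also have "\<dots> = (\<Sum>k<2 ^ m. g k)"
  proof (rule sum.reindex_bij_witness[of _ "\<lambda>k. (and k \<mu>, xor k (and k \<mu>))" "\<lambda>(s, k). or k s"])
    fix a assume "a \<in> ?A \<times> ?B"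
    then obtain s k where a: "a = (s, k)" "s \<in> ?A" "k \<in> ?B" by auto
    then have "and (or k s) \<mu> = s"
      by (intro bit_eqI) (auto simp: bit_and_iff bit_or_iff \<mu>)
    moreover from a have "xor (or k s) s = k"
      by (intro bit_eqI) (auto simp: bit_xor_iff bit_or_iff)
    ultimately show "(case case a of (s, k) \<Rightarrow> or k s of k \<Rightarrow> (and k \<mu>, xor k (and k \<mu>))) = a"
      by (simp add: a)
    show "(case a of (s, k) \<Rightarrow> or k s) \<in> {..<2 ^ m}"
      using a by (auto simp: nat_less_power2_iff_bits bit_or_iff)
    show "g (case a of (s, k) \<Rightarrow> or k s) = (case a of (s, k) \<Rightarrow> g (or k s))"
      by (simp add: a)
  next
    fix k :: nat assume k: "k \<in> {..<2 ^ m}"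
    have "or (xor k (and k \<mu>)) (and k \<mu>) = k"
      by (intro bit_eqI) (auto simp: bit_and_iff bit_xor_iff bit_or_iff)
    then show "(case (and k \<mu>, xor k (and k \<mu>)) of (s, k) \<Rightarrow> or k s) = k" by simp
    show "(and k \<mu>, xor k (and k \<mu>)) \<in> ?A \<times> ?B"
      using k by (auto simp: nat_less_power2_iff_bits bit_and_iff bit_xor_iff \<mu>)
  qed
  finally show ?thesis .
qed


definition ptrace :: "nat \<Rightarrow> nat set \<Rightarrow> complex vec \<Rightarrow> complex mat" where
  "ptrace D S \<psi> = mat D D (\<lambda>(k, k').
     if (\<forall>p\<in>S. \<not> bit k p) \<and> (\<forall>p\<in>S. \<not> bit k' p) then
       (\<Sum>s\<in>{s. s < D \<and> (\<forall>p. bit s p \<longrightarrow> p \<in> S)}. \<psi> $ (or k s) * cnj (\<psi> $ (or k' s)))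
     else 0)"

lemma reduced_state_ptrace:
  "reduced_state n q w T Us S x = ptrace (qdim q w) S (alg_state n q w Us x T)"
  by (simp add: reduced_state_def ptrace_def Let_def)

lemma ptrace_carrier [simp]: "ptrace D S \<psi> \<in> carrier_mat D D"
  by (simp add: ptrace_def)

lemma ptrace_diff_hermitian: "mat_adjoint (ptrace D S \<psi> - ptrace D S \<phi>) = ptrace D S \<psi> - ptrace D S \<phi>"
proof (rule eq_matI)
  fix i j assume "i < dim_row (ptrace D S \<psi> - ptrace D S \<phi>)" "j < dim_col (ptrace D S \<psi> - ptrace D S \<phi>)"
  then have ij: "i < D" "j < D" by (auto simp: ptrace_def)
  have "cnj (ptrace D S \<chi> $$ (j, i)) = ptrace D S \<chi> $$ (i, j)" for \<chi>
    using ij by (auto simp: ptrace_def mult.commute intro!: sum.cong)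
  then show "mat_adjoint (ptrace D S \<psi> - ptrace D S \<phi>) $$ (i, j) = (ptrace D S \<psi> - ptrace D S \<phi>) $$ (i, j)"
    using ij by (simp add: ptrace_def)
qed (auto simp: ptrace_def)

text \<open>Fixing the traced-out bits to \<open>s\<close> cuts a vector into slices, and the
  reduced state is the sum of the rank-one matrices of the slices. The quadratic form estimate
  applies to each slice; Cauchy-Schwarz over \<open>s\<close> reassembles the norms, since the
  squared norms of the slices add up.\<close>

lemma trace_norm_ptrace_diff:
  assumes S: "finite S" and \<psi>: "\<psi> \<in> carrier_vec (2 ^ m)" and \<phi>: "\<phi> \<in> carrier_vec (2 ^ m)"
  shows "trace_norm (2 ^ m) (ptrace (2 ^ m) S \<psi> - ptrace (2 ^ m) S \<phi>)
    \<le> vnorm (\<psi> - \<phi>) * vnorm \<psi> + vnorm (\<psi> - \<phi>) * vnorm \<phi>"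
proof -
  define D where "D = (2::nat) ^ m"
  define Ss where "Ss = {s. s < D \<and> (\<forall>p. bit s p \<longrightarrow> p \<in> S)}"
  define slice where "slice \<chi> s = vec D (\<lambda>k. if \<forall>p\<in>S. \<not> bit k p then \<chi> $ (or k s) else 0)"
    for \<chi> :: "complex vec" and s
  have slice_c [simp]: "slice \<chi> s \<in> carrier_vec D" for \<chi> s by (simp add: slice_def)
  have or_less: "or k s < D" if "k < D" "s < D" for k s
    using that unfolding D_def nat_less_power2_iff_bits by (auto simp: bit_or_iff)
  have slice_diff: "slice \<psi> s - slice \<phi> s = slice (\<psi> - \<phi>) s" if "s \<in> Ss" for s
    by (rule eq_vecI) (use that \<psi> \<phi> or_less in \<open>auto simp: slice_def Ss_def D_def[symmetric]\<close>)
  have slice_norm: "L2_set (\<lambda>s. vnorm (slice \<chi> s)) Ss = vnorm \<chi>" if "\<chi> \<in> carrier_vec D" for \<chi>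
  proof -
    have "(vnorm (slice \<chi> s))\<^sup>2 = (\<Sum>k<D. if \<forall>p\<in>S. \<not> bit k p then (cmod (\<chi> $ (or k s)))\<^sup>2 else 0)" for s
      unfolding vnorm_sq by (simp add: slice_def if_distrib[of "\<lambda>z. (cmod z)\<^sup>2"] cong: if_cong)
    then have "(\<Sum>s\<in>Ss. (vnorm (slice \<chi> s))\<^sup>2) = (vnorm \<chi>)\<^sup>2"
      using sum_split_bits[OF S, where m = m and g = "\<lambda>k. (cmod (\<chi> $ k))\<^sup>2"] that
      by (simp add: D_def Ss_def vnorm_sq)
    then show ?thesis by (simp add: L2_set_def)
  qed
  define A where "A = ptrace D S \<psi> - ptrace D S \<phi>"
  have Ac: "A \<in> carrier_mat D D" unfolding A_def by (intro minus_carrier_mat ptrace_carrier)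
  have Ah: "mat_adjoint A = A" unfolding A_def by (rule ptrace_diff_hermitian)
  from trace_norm_attained[OF Ac Ah] obtain W where W: "unitary_mat D W"
    and t: "complex_of_real (trace_norm D A) = mat_tr (A * W)" by blast
  note Wc = unitary_mat_carrier[OF W]
  have pt: "ptrace D S \<chi> $$ (k, k') = (\<Sum>s\<in>Ss. slice \<chi> s $ k * cnj (slice \<chi> s $ k'))"
    if "k < D" "k' < D" for \<chi> k k'
    using that by (auto simp: ptrace_def slice_def Ss_def intro!: sum.neutral)
  have quad: "(W *\<^sub>v a) \<bullet>c a = (\<Sum>k'<D. \<Sum>k<D. W $$ (k', k) * a $ k * cnj (a $ k'))"
    if "a \<in> carrier_vec D" for a
    using that Wc by (simp add: scalar_prod_def lessThan_atLeast0 sum_distrib_right)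
  have form: "(\<Sum>k<D. \<Sum>k'<D. ptrace D S \<chi> $$ (k, k') * W $$ (k', k)) =
      (\<Sum>s\<in>Ss. (W *\<^sub>v slice \<chi> s) \<bullet>c slice \<chi> s)" for \<chi>
  proof -
    have "(\<Sum>k<D. \<Sum>k'<D. ptrace D S \<chi> $$ (k, k') * W $$ (k', k)) =
        (\<Sum>k<D. \<Sum>k'<D. \<Sum>s\<in>Ss. W $$ (k', k) * slice \<chi> s $ k * cnj (slice \<chi> s $ k'))"
      by (intro sum.cong refl) (simp add: pt sum_distrib_left mult_ac)
    also have "\<dots> = (\<Sum>s\<in>Ss. \<Sum>k'<D. \<Sum>k<D. W $$ (k', k) * slice \<chi> s $ k * cnj (slice \<chi> s $ k'))"
      by (rule sum_rotate3)
    also have "\<dots> = (\<Sum>s\<in>Ss. (W *\<^sub>v slice \<chi> s) \<bullet>c slice \<chi> s)"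
      unfolding quad[OF slice_c] ..
    finally show ?thesis .
  qed
  have "mat_tr (A * W) = (\<Sum>k<D. \<Sum>k'<D. ptrace D S \<psi> $$ (k, k') * W $$ (k', k))
      - (\<Sum>k<D. \<Sum>k'<D. ptrace D S \<phi> $$ (k, k') * W $$ (k', k))"
    unfolding mat_tr_mult[OF Ac Wc] sum_subtractf[symmetric]
    by (intro sum.cong refl) (simp add: A_def ptrace_def left_diff_distrib)
  also have "\<dots> = (\<Sum>s\<in>Ss. (W *\<^sub>v slice \<psi> s) \<bullet>c slice \<psi> s - (W *\<^sub>v slice \<phi> s) \<bullet>c slice \<phi> s)"
    unfolding form sum_subtractf ..
  finally have "trace_norm D A \<le> cmod (\<Sum>s\<in>Ss. (W *\<^sub>v slice \<psi> s) \<bullet>c slice \<psi> s - (W *\<^sub>v slice \<phi> s) \<bullet>c slice \<phi> s)"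
    using t by (metis abs_ge_self norm_of_real)
  also have "\<dots> \<le> (\<Sum>s\<in>Ss. vnorm (slice (\<psi> - \<phi>) s) * vnorm (slice \<psi> s) + vnorm (slice (\<psi> - \<phi>) s) * vnorm (slice \<phi> s))"
    by (rule order_trans[OF norm_sum], rule sum_mono)
      (use quadratic_form_diff[OF W slice_c slice_c] slice_diff in metis)
  also have "\<dots> = (\<Sum>s\<in>Ss. \<bar>vnorm (slice (\<psi> - \<phi>) s)\<bar> * \<bar>vnorm (slice \<psi> s)\<bar>)
      + (\<Sum>s\<in>Ss. \<bar>vnorm (slice (\<psi> - \<phi>) s)\<bar> * \<bar>vnorm (slice \<phi> s)\<bar>)"
    by (simp add: sum.distrib)
  also have "\<dots> \<le> vnorm (\<psi> - \<phi>) * vnorm \<psi> + vnorm (\<psi> - \<phi>) * vnorm \<phi>"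
    using L2_set_mult_ineq[of "\<lambda>s. vnorm (slice (\<psi> - \<phi>) s)" "\<lambda>s. vnorm (slice \<psi> s)" Ss]
      L2_set_mult_ineq[of "\<lambda>s. vnorm (slice (\<psi> - \<phi>) s)" "\<lambda>s. vnorm (slice \<phi> s)" Ss]
      slice_norm[of \<psi>] slice_norm[of \<phi>] slice_norm[of "\<psi> - \<phi>"] \<psi> \<phi>
    by (simp add: D_def)
  finally show ?thesis by (simp add: A_def D_def)
qed

section \<open>The adversary argument\<close>

lemma oracle_target_less:
  assumes "k < qdim q w"
  shows "oracle_target n w x k < qdim q w"
  using assms unfolding oracle_target_def Let_def qdim_def nat_less_power2_iff_bits
  by (auto simp: bit_xor_iff bit_exp_iff)

lemma oracle_target_index: "oracle_target n w x k div 2 ^ Suc w = k div 2 ^ Suc w"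
proof -
  have "drop_bit (Suc w) (xor k (2 ^ w)) = drop_bit (Suc w) k"
    by (rule bit_eqI) (auto simp: bit_drop_bit_eq bit_xor_iff bit_exp_iff)
  then show ?thesis by (simp only: oracle_target_def Let_def drop_bit_eq_div split: if_split) simp
qed

lemma oracle_target_invol [simp]: "oracle_target n w x (oracle_target n w x k) = k"
proof -
  have "xor (xor k (2 ^ w)) (2 ^ w) = k" by (simp add: xor.assoc)
  then show ?thesis
    using oracle_target_index[of n w x k] by (auto simp: oracle_target_def Let_def)
qed

lemma oracle_mat_carrier [simp]: "oracle_mat n q w x \<in> carrier_mat (qdim q w) (qdim q w)"
  by (simp add: oracle_mat_def)

lemma oracle_mat_index:
  assumes v: "v \<in> carrier_vec (qdim q w)" and k: "k < qdim q w"
  shows "(oracle_mat n q w x *\<^sub>v v) $ k = v $ (oracle_target n w x k)"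
proof -
  have eq: "k = oracle_target n w x j \<longleftrightarrow> j = oracle_target n w x k" for j
    by (metis oracle_target_invol)
  have "(oracle_mat n q w x *\<^sub>v v) $ k = (\<Sum>j<qdim q w. (if k = oracle_target n w x j then 1 else 0) * v $ j)"
    using v k by (simp add: oracle_mat_def scalar_prod_def lessThan_atLeast0)
  also have "\<dots> = (\<Sum>j<qdim q w. if j = oracle_target n w x k then v $ j else 0)"
    unfolding eq by (rule sum.cong) auto
  also have "\<dots> = v $ (oracle_target n w x k)"
    using oracle_target_less[OF k] by simp
  finally show ?thesis .
qed

text \<open>For a unit vector, the probability that measuring the index register yields an element
  of \<open>I\<close>.\<close>

definition index_mass :: "nat \<Rightarrow> nat set \<Rightarrow> complex vec \<Rightarrow> real" where
  "index_mass w I v = (\<Sum>k\<in>{k. k < dim_vec v \<and> k div 2 ^ Suc w \<in> I}. (cmod (v $ k))\<^sup>2)"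

lemma index_mass_nonneg: "0 \<le> index_mass w I v"
  unfolding index_mass_def by (intro sum_nonneg) auto

lemma index_mass_sum:
  assumes "finite I"
  shows "index_mass w I v = (\<Sum>i\<in>I. index_mass w {i} v)"
proof -
  have "{k. k < dim_vec v \<and> k div 2 ^ Suc w \<in> I} =
      (\<Union>i\<in>I. {k. k < dim_vec v \<and> k div 2 ^ Suc w \<in> {i}})" by auto
  then show ?thesis
    unfolding index_mass_def by (simp only:, subst sum.UNION_disjoint) (use assms in auto)
qed

lemma index_mass_le: "index_mass w I v \<le> (vnorm v)\<^sup>2"
  unfolding index_mass_def vnorm_sq by (intro sum_mono2) auto

text \<open>On labels whose index lies outside \<open>I\<close> both oracles are the same
  permutation, so this part of the inner product is unchanged. The labels over \<open>I\<close> are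
  mapped among themselves, and Cauchy-Schwarz bounds their part before and after the query, whence
  the factor 2.\<close>

lemma oracle_step:
  fixes n :: nat and x y :: "bool list"
  assumes u: "u \<in> carrier_vec (qdim q w)" and v: "v \<in> carrier_vec (qdim q w)"
  defines "I \<equiv> {i. i < n \<and> x ! i \<noteq> y ! i}"
  shows "cmod ((oracle_mat n q w x *\<^sub>v u) \<bullet>c (oracle_mat n q w y *\<^sub>v v) - u \<bullet>c v)
    \<le> 2 * (sqrt (index_mass w I u) * sqrt (index_mass w I v))"
proof -
  let ?D = "qdim q w" and ?tx = "oracle_target n w x" and ?ty = "oracle_target n w y"
  define bad where "bad = {k. k < ?D \<and> k div 2 ^ Suc w \<in> I}"
  define good where "good = {k. k < ?D \<and> k div 2 ^ Suc w \<notin> I}"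
  have un: "{..<?D} = bad \<union> good" by (auto simp: bad_def good_def)
  have split: "(\<Sum>k<?D. h k) = sum h bad + sum h good" for h :: "nat \<Rightarrow> complex"
    unfolding un by (rule sum.union_disjoint) (auto simp: bad_def good_def)
  have tgt_good: "oracle_target n w z k \<in> good" if "k \<in> good" for z k
    using that oracle_target_less oracle_target_index by (auto simp: good_def)
  have tgt_bad: "oracle_target n w z k \<in> bad" if "k \<in> bad" for z k
    using that oracle_target_less oracle_target_index by (auto simp: bad_def)
  have bad_re: "(\<Sum>k\<in>bad. h (oracle_target n w z k)) = sum h bad" for h :: "nat \<Rightarrow> real" and z
    by (rule sum.reindex_bij_witness[of _ "oracle_target n w z" "oracle_target n w z"])
      (auto simp: tgt_bad)
  have cs: "cmod (\<Sum>k\<in>bad. u $ (\<sigma> k) * cnj (v $ (\<tau> k))) \<le> sqrt (index_mass w I u) * sqrt (index_mass w I v)"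
    if \<sigma>: "(\<Sum>k\<in>bad. (cmod (u $ (\<sigma> k)))\<^sup>2) = index_mass w I u"
      and \<tau>: "(\<Sum>k\<in>bad. (cmod (v $ (\<tau> k)))\<^sup>2) = index_mass w I v" for \<sigma> \<tau>
  proof -
    have "cmod (\<Sum>k\<in>bad. u $ (\<sigma> k) * cnj (v $ (\<tau> k))) \<le> (\<Sum>k\<in>bad. \<bar>cmod (u $ (\<sigma> k))\<bar> * \<bar>cmod (v $ (\<tau> k))\<bar>)"
      by (rule order_trans[OF norm_sum], rule sum_mono) (simp add: norm_mult)
    also have "\<dots> \<le> L2_set (\<lambda>k. cmod (u $ (\<sigma> k))) bad * L2_set (\<lambda>k. cmod (v $ (\<tau> k))) bad"
      by (rule L2_set_mult_ineq)
    finally show ?thesis unfolding L2_set_def \<sigma> \<tau> .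
  qed
  have mass: "(\<Sum>k\<in>bad. (cmod (u $ k))\<^sup>2) = index_mass w I u"
    "(\<Sum>k\<in>bad. (cmod (v $ k))\<^sup>2) = index_mass w I v"
    using u v by (auto simp: index_mass_def bad_def)
  have same: "?ty k = ?tx k" if "k \<in> good" for k
    using that by (auto simp: oracle_target_def Let_def good_def I_def)
  have "(oracle_mat n q w x *\<^sub>v u) \<bullet>c (oracle_mat n q w y *\<^sub>v v) = (\<Sum>k<?D. u $ (?tx k) * cnj (v $ (?ty k)))"
    using oracle_mat_index[OF u] oracle_mat_index[OF v] carrier_matD[OF oracle_mat_carrier[of n q w y]]
      carrier_matD[OF oracle_mat_carrier[of n q w x]]
    by (simp add: scalar_prod_def[of "oracle_mat n q w x *\<^sub>v u"] lessThan_atLeast0 del: index_mult_mat_vec)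
  also have "\<dots> = (\<Sum>k\<in>bad. u $ (?tx k) * cnj (v $ (?ty k))) + (\<Sum>k\<in>good. u $ (?tx k) * cnj (v $ (?tx k)))"
    unfolding split using same by simp
  also have "(\<Sum>k\<in>good. u $ (?tx k) * cnj (v $ (?tx k))) = (\<Sum>k\<in>good. u $ k * cnj (v $ k))"
    by (rule sum.reindex_bij_witness[of _ ?tx ?tx]) (auto simp: tgt_good)
  finally have new: "(oracle_mat n q w x *\<^sub>v u) \<bullet>c (oracle_mat n q w y *\<^sub>v v) =
    (\<Sum>k\<in>bad. u $ (?tx k) * cnj (v $ (?ty k))) + (\<Sum>k\<in>good. u $ k * cnj (v $ k))" .
  have old: "u \<bullet>c v = (\<Sum>k\<in>bad. u $ k * cnj (v $ k)) + (\<Sum>k\<in>good. u $ k * cnj (v $ k))"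
    unfolding split[symmetric] using v by (simp add: scalar_prod_def lessThan_atLeast0)
  have "cmod ((\<Sum>k\<in>bad. u $ (?tx k) * cnj (v $ (?ty k))) - (\<Sum>k\<in>bad. u $ k * cnj (v $ k)))
      \<le> sqrt (index_mass w I u) * sqrt (index_mass w I v) + sqrt (index_mass w I u) * sqrt (index_mass w I v)"
    by (rule order_trans[OF norm_triangle_ineq4], intro add_mono cs)
      (simp_all add: mass bad_re[of "\<lambda>k. (cmod (u $ k))\<^sup>2"] bad_re[of "\<lambda>k. (cmod (v $ k))\<^sup>2"])
  then show ?thesis unfolding new old by simp
qed

lemma alg_state_carrier:
  assumes "valid_alg n q w T Us" "t \<le> T"
  shows "alg_state n q w Us x t \<in> carrier_vec (qdim q w)"
  using assms(2)
proof (cases t)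
  case 0
  have "Us 0 \<in> carrier_mat (qdim q w) (qdim q w)"
    using assms by (auto simp: valid_alg_def unitary_mat_def)
  from carrier_matD(1)[OF this] show ?thesis using 0 by (intro carrier_vecI) simp
next
  case (Suc s)
  have "Us (Suc s) \<in> carrier_mat (qdim q w) (qdim q w)"
    using assms Suc by (auto simp: valid_alg_def unitary_mat_def)
  from carrier_matD(1)[OF this] show ?thesis using Suc by (intro carrier_vecI) simp
qed

text \<open>Common unitaries preserve the inner product of the two runs, which starts at 1; only the
  oracle calls can move it.\<close>

lemma alg_state_progress:
  fixes n :: nat and x y :: "bool list"
  assumes V: "valid_alg n q w T Us" and "t \<le> T"
  defines "I \<equiv> {i. i < n \<and> x ! i \<noteq> y ! i}"
  shows "cmod (alg_state n q w Us x t \<bullet>c alg_state n q w Us y t - 1) \<le>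
    (\<Sum>s<t. 2 * (sqrt (index_mass w I (alg_state n q w Us x s)) *
                  sqrt (index_mass w I (alg_state n q w Us y s))))"
  using assms(2)
proof (induction t)
  case 0
  have U: "unitary_mat (qdim q w) (Us 0)" using V by (simp add: valid_alg_def)
  have "qdim q w > 0" by (simp add: qdim_def)
  moreover have "conjugate (unit_vec (qdim q w) 0) = (unit_vec (qdim q w) 0 :: complex vec)"
    by (rule eq_vecI) (auto simp: unit_vec_def)
  ultimately have "unit_vec (qdim q w) 0 \<bullet>c unit_vec (qdim q w) 0 = (1 :: complex)"
    by simp
  then show ?case using unitary_preserves_cscalar_prod[OF U, of "unit_vec (qdim q w) 0" "unit_vec (qdim q w) 0"]
    by simp
next
  case (Suc t)
  let ?u = "alg_state n q w Us x t" and ?v = "alg_state n q w Us y t"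
  have c: "?u \<in> carrier_vec (qdim q w)" "?v \<in> carrier_vec (qdim q w)"
    using alg_state_carrier[OF V] Suc.prems by auto
  have U: "unitary_mat (qdim q w) (Us (Suc t))" using V Suc.prems by (simp add: valid_alg_def)
  have "alg_state n q w Us x (Suc t) \<bullet>c alg_state n q w Us y (Suc t) =
      (oracle_mat n q w x *\<^sub>v ?u) \<bullet>c (oracle_mat n q w y *\<^sub>v ?v)"
    unfolding alg_state.simps
    by (intro unitary_preserves_cscalar_prod[OF U] mult_mat_vec_carrier[OF oracle_mat_carrier] c)
  then have "cmod (alg_state n q w Us x (Suc t) \<bullet>c alg_state n q w Us y (Suc t) - ?u \<bullet>c ?v) \<le>
      2 * (sqrt (index_mass w I ?u) * sqrt (index_mass w I ?v))"
    using oracle_step[OF c, of n x y] unfolding I_def by simp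
  moreover have "cmod (?u \<bullet>c ?v - 1) \<le> (\<Sum>s<t. 2 * (sqrt (index_mass w I (alg_state n q w Us x s)) *
                  sqrt (index_mass w I (alg_state n q w Us y s))))"
    using Suc by simp
  ultimately show ?case
    using norm_triangle_ineq[of "alg_state n q w Us x (Suc t) \<bullet>c alg_state n q w Us y (Suc t) - ?u \<bullet>c ?v" "?u \<bullet>c ?v - 1"]
    by simp
qed

lemma alg_state_norm:
  assumes V: "valid_alg n q w T Us" and t: "t \<le> T"
  shows "vnorm (alg_state n q w Us x t) = 1"
proof -
  \<comment> \<open>For two equal inputs the set of differing indices is empty, so the progress
    bound is 0.\<close>
  have "alg_state n q w Us x t \<bullet>c alg_state n q w Us x t = 1"
    using alg_state_progress[OF V t, of x x] by (simp add: index_mass_def)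
  then have "(vnorm (alg_state n q w Us x t))\<^sup>2 = 1"
    unfolding cscalar_prod_vnorm by (simp only: of_real_eq_1_iff)
  then show ?thesis using vnorm_nonneg[of "alg_state n q w Us x t"] by (simp add: power2_eq_1_iff)
qed

lemma vnorm_diff_sq:
  assumes "u \<in> carrier_vec d" "v \<in> carrier_vec d"
  shows "(vnorm (u - v))\<^sup>2 = (vnorm u)\<^sup>2 + (vnorm v)\<^sup>2 - 2 * Re (u \<bullet>c v)"
proof -
  have sq: "(cmod (a - b))\<^sup>2 = (cmod a)\<^sup>2 + (cmod b)\<^sup>2 - 2 * Re (a * cnj b)" for a b
    unfolding cmod_power2 by (simp add: power2_eq_square algebra_simps)
  have "(vnorm (u - v))\<^sup>2 = (\<Sum>k<d. (cmod (u $ k))\<^sup>2 + (cmod (v $ k))\<^sup>2 - 2 * Re (u $ k * cnj (v $ k)))"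
    unfolding vnorm_sq sq[symmetric] using assms by simp
  also have "\<dots> = (vnorm u)\<^sup>2 + (vnorm v)\<^sup>2 - 2 * Re (u \<bullet>c v)"
    unfolding vnorm_sq scalar_prod_def using assms
    by (simp add: sum.distrib sum_subtractf lessThan_atLeast0 flip: sum_distrib_left)
  finally show ?thesis .
qed

text \<open>Inputs are represented by the sets of their 1-bits, for which flipping a block is a
  symmetric difference.\<close>

definition inp :: "nat \<Rightarrow> nat set \<Rightarrow> bool list" where
  "inp n X = map (\<lambda>i. i \<in> X) [0..<n]"

lemma length_inp [simp]: "length (inp n X) = n"
  by (simp add: inp_def)

lemma nth_inp [simp]: "i < n \<Longrightarrow> inp n X ! i \<longleftrightarrow> i \<in> X"
  by (simp add: inp_def)

text \<open>The weights are cut off at time \<open>T\<close> because the locale bounds them at all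
  times, whereas \<open>valid_alg\<close> makes no claim on the matrices after
  \<open>T\<close>.\<close>

lemma distinguisher_query_weights:
  assumes V: "valid_alg n q w T Us" and S: "S \<subseteq> {..<q + 1 + w}"
    and dist: "\<And>x y. length x = n \<Longrightarrow> length y = n \<Longrightarrow> f x \<noteq> f y \<Longrightarrow>
      trace_dist (qdim q w) (reduced_state n q w T Us S x) (reduced_state n q w T Us S y) \<ge> 1/6"
  shows "query_weights n (\<lambda>X. f (inp n X)) T 144
    (\<lambda>X t i. if t < T then index_mass w {i} (alg_state n q w Us (inp n X) t) else 0)"
proof
  fix X t i
  show "0 \<le> (if t < T then index_mass w {i} (alg_state n q w Us (inp n X) t) else 0)"
    by (simp add: index_mass_nonneg)
next
  fix X t
  have "(\<Sum>i<n. index_mass w {i} (alg_state n q w Us (inp n X) t)) \<le> 1" if "t < T"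
  proof -
    have "(\<Sum>i<n. index_mass w {i} (alg_state n q w Us (inp n X) t)) =
        index_mass w {..<n} (alg_state n q w Us (inp n X) t)"
      by (rule index_mass_sum[symmetric]) simp
    also have "\<dots> \<le> 1"
      using index_mass_le[of w "{..<n}" "alg_state n q w Us (inp n X) t"] alg_state_norm[OF V, of t "inp n X"] that by simp
    finally show ?thesis .
  qed
  then show "(\<Sum>i<n. if t < T then index_mass w {i} (alg_state n q w Us (inp n X) t) else 0) \<le> 1"
    by (cases "t < T") simp_all
next
  fix X Y
  assume X: "X \<subseteq> {..<n}" and Y: "Y \<subseteq> {..<n}" and ne: "f (inp n X) \<noteq> f (inp n Y)"
  let ?x = "inp n X" and ?y = "inp n Y"
  let ?u = "alg_state n q w Us ?x T" and ?v = "alg_state n q w Us ?y T"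
  have I: "{i. i < n \<and> ?x ! i \<noteq> ?y ! i} = sym_diff X Y" using X Y by auto
  have finI: "finite (sym_diff X Y)" using X Y by (meson finite_Diff finite_UnI finite_lessThan finite_subset)
  have c: "?u \<in> carrier_vec (qdim q w)" "?v \<in> carrier_vec (qdim q w)" using alg_state_carrier[OF V] by auto
  have finS: "finite S" using S finite_subset by blast
  have n1: "vnorm ?u = 1" "vnorm ?v = 1" using alg_state_norm[OF V] by auto
  \<comment> \<open>Origin of 144: trace distance 1/6 is trace norm 1/3, which is at most twice the
    distance of the unit vectors. That distance is thus at least 1/6, and its square being
    \<open>2 - 2 * Re\<close> of the inner product leaves a deficit of 1/72. The factor 2 of each
    query doubles the denominator.\<close>
  have "1/3 \<le> trace_norm (qdim q w) (ptrace (qdim q w) S ?u - ptrace (qdim q w) S ?v)"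
    using dist[of ?x ?y] ne by (simp add: trace_dist_def reduced_state_ptrace)
  also have "\<dots> \<le> vnorm (?u - ?v) * vnorm ?u + vnorm (?u - ?v) * vnorm ?v"
    using trace_norm_ptrace_diff[OF finS, of ?u "q + 1 + w" ?v] c unfolding qdim_def by simp
  finally have "1/6 \<le> vnorm (?u - ?v)" by (simp add: n1)
  then have "(1/6)\<^sup>2 \<le> (vnorm (?u - ?v))\<^sup>2" by (intro power_mono) auto
  then have "1/72 \<le> 1 - Re (?u \<bullet>c ?v)"
    unfolding vnorm_diff_sq[OF c] by (simp add: n1 power2_eq_square)
  also have "\<dots> \<le> cmod (?u \<bullet>c ?v - 1)"
    using abs_Re_le_cmod[of "?u \<bullet>c ?v - 1"] by simp
  also have "\<dots> \<le> (\<Sum>t<T. 2 * (sqrt (index_mass w (sym_diff X Y) (alg_state n q w Us ?x t)) *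
                  sqrt (index_mass w (sym_diff X Y) (alg_state n q w Us ?y t))))"
    using alg_state_progress[OF V order_refl, of ?x ?y] unfolding I .
  also have "\<dots> = 2 * (\<Sum>t<T. sqrt (\<Sum>i\<in>sym_diff X Y. index_mass w {i} (alg_state n q w Us ?x t)) *
                  sqrt (\<Sum>i\<in>sym_diff X Y. index_mass w {i} (alg_state n q w Us ?y t)))"
    unfolding index_mass_sum[OF finI] sum_distrib_left[symmetric] ..
  finally show "1 \<le> real 144 * (\<Sum>t<T.
      sqrt (\<Sum>i\<in>sym_diff X Y. if t < T then index_mass w {i} (alg_state n q w Us ?x t) else 0) *
      sqrt (\<Sum>i\<in>sym_diff X Y. if t < T then index_mass w {i} (alg_state n q w Us ?y t) else 0))"
    by simp
qed

section \<open>Simulation of adaptive queries\<close>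

text \<open>The complements of domain and image have equal size, so any matching of them completes
  \<open>g\<close> to a permutation, whose matrix is unitary.\<close>

lemma injective_map_extends_to_unitary:
  assumes R: "R \<subseteq> {..<d}" and g: "inj_on g R" "g ` R \<subseteq> {..<d}"
  shows "\<exists>U. unitary_mat d U \<and> (\<forall>j\<in>R. U *\<^sub>v unit_vec d j = unit_vec d (g j))"
proof -
  have fin: "finite R" using R finite_subset by blast
  have "card ({..<d} - R) = card ({..<d} - g ` R)"
    using R g fin by (simp add: card_Diff_subset card_image)
  then obtain h where h: "bij_betw h ({..<d} - R) ({..<d} - g ` R)"
    using finite_same_card_bij[of "{..<d} - R" "{..<d} - g ` R"] by auto
  define \<pi> where "\<pi> j = (if j \<in> R then g j else h j)" for j
  have "bij_betw \<pi> R (g ` R)"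
    using g(1) by (subst bij_betw_cong[of _ _ g]) (auto simp: \<pi>_def inj_on_imp_bij_betw)
  moreover have "bij_betw \<pi> ({..<d} - R) ({..<d} - g ` R)"
    using h by (subst bij_betw_cong[of _ _ h]) (auto simp: \<pi>_def)
  ultimately have "bij_betw \<pi> (R \<union> ({..<d} - R)) (g ` R \<union> ({..<d} - g ` R))"
    by (rule bij_betw_combine) auto
  then have \<pi>: "bij_betw \<pi> {..<d} {..<d}" using R g by (simp add: Un_absorb1)
  define U :: "complex mat" where "U = mat d d (\<lambda>(i, j). if i = \<pi> j then 1 else 0)"
  have inj: "\<pi> i = \<pi> j \<longleftrightarrow> i = j" if "i < d" "j < d" for i j
    using \<pi> that by (auto simp: bij_betw_def inj_on_def)
  have less: "\<pi> j < d" if "j < d" for j using \<pi> that by (auto simp: bij_betw_def)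
  have "mat_adjoint U * U = 1\<^sub>m d"
  proof (rule eq_matI)
    fix i j assume "i < dim_row (1\<^sub>m d :: complex mat)" "j < dim_col (1\<^sub>m d :: complex mat)"
    then have ij: "i < d" "j < d" by auto
    have "(mat_adjoint U * U) $$ (i, j) = (\<Sum>k<d. (if k = \<pi> i then 1 else 0) * (if k = \<pi> j then 1 else 0))"
      using ij by (auto simp: U_def scalar_prod_def lessThan_atLeast0 intro!: sum.cong)
    also have "\<dots> = (\<Sum>k<d. if k = \<pi> i then (if i = j then 1 else 0) else 0)"
      by (rule sum.cong) (auto simp: inj[OF ij])
    also have "\<dots> = 1\<^sub>m d $$ (i, j)" using ij less by simp
    finally show "(mat_adjoint U * U) $$ (i, j) = 1\<^sub>m d $$ (i, j)" .
  qed (auto simp: U_def)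
  moreover from this have "U * mat_adjoint U = 1\<^sub>m d"
    by (intro mat_mult_left_right_inverse[of "mat_adjoint U" d U]) (auto simp: U_def)
  ultimately have "unitary_mat d U" by (simp add: unitary_mat_def U_def)
  moreover have "U *\<^sub>v unit_vec d j = unit_vec d (g j)" if "j \<in> R" for j
  proof -
    have "j < d" "g j < d" using that R g by auto
    then show ?thesis
      using that by (intro eq_vecI) (auto simp: U_def \<pi>_def)
  qed
  ultimately show ?thesis by blast
qed

lemma oracle_mat_unit_vec:
  assumes k: "k < qdim q w"
  shows "oracle_mat n q w x *\<^sub>v unit_vec (qdim q w) k = unit_vec (qdim q w) (oracle_target n w x k)"
proof (rule eq_vecI)
  fix j assume "j < dim_vec (unit_vec (qdim q w) (oracle_target n w x k) :: complex vec)"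
  then have j: "j < qdim q w" by simp
  have "oracle_target n w x j = k \<longleftrightarrow> j = oracle_target n w x k" by (metis oracle_target_invol)
  then show "(oracle_mat n q w x *\<^sub>v unit_vec (qdim q w) k) $ j = (unit_vec (qdim q w) (oracle_target n w x k) :: complex vec) $ j"
    using oracle_mat_index[OF _ j, of "unit_vec (qdim q w) k" n x] oracle_target_less[OF j, of n x] oracle_target_less[OF k, of n x] j k
    by (simp del: index_mult_mat_vec)
qed (auto simp: oracle_mat_def)

text \<open>An adaptive classical query strategy is simulated by keeping the answers received so far in
  the workspace; the unitaries between the queries are permutations of the basis states.\<close>

lemma adaptive_queries_simulation:
  fixes idx :: "nat \<Rightarrow> nat set \<Rightarrow> nat"
  assumes n: "n \<le> 2 ^ q"
    and bound: "\<And>t X. X \<subseteq> {..<n} \<Longrightarrow> idx t X < 2 ^ q"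
    and determined: "\<And>t X Y. X \<subseteq> {..<n} \<Longrightarrow> Y \<subseteq> {..<n} \<Longrightarrow>
      (\<And>s. s < t \<Longrightarrow> (idx s X \<in> X) = (idx s Y \<in> Y)) \<Longrightarrow> idx t X = idx t Y"
  shows "\<exists>w Us L. valid_alg n q w T Us \<and>
    (\<forall>X. X \<subseteq> {..<n} \<longrightarrow> L X < qdim q w \<and> alg_state n q w Us (inp n X) T = unit_vec (qdim q w) (L X)) \<and>
    (\<forall>X Y. X \<subseteq> {..<n} \<longrightarrow> Y \<subseteq> {..<n} \<longrightarrow> L X = L Y \<longrightarrow>
       (\<forall>s<T. idx s X = idx s Y \<and> (idx s X \<in> X) = (idx s Y \<in> Y)))"
proof -
  define w where "w = T"
  define D where "D = qdim q w"
  define code :: "nat \<Rightarrow> nat set \<Rightarrow> nat" where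
    "code t X = horner_sum of_bool 2 (map (\<lambda>s. idx s X \<in> X) [0..<t])" for t X
  define label where "label t X = or (push_bit (Suc w) (idx t X)) (code t X)" for t X
  define mid where "mid t X = oracle_target n w (inp n X) (label t X)" for t X
  define agree where "agree t X Y \<longleftrightarrow> (\<forall>s<t. (idx s X \<in> X) = (idx s Y \<in> Y))" for t X Y
  have bit_code: "bit (code t X) p \<longleftrightarrow> p < t \<and> idx p X \<in> X" for t X p
    by (auto simp: code_def bit_horner_sum_bit_iff)
  have bit_label: "bit (label t X) p \<longleftrightarrow>
      (Suc w \<le> p \<and> bit (idx t X) (p - Suc w)) \<or> (p < t \<and> idx p X \<in> X)" for t X p
    unfolding label_def by (simp only: bit_or_iff bit_push_bit_iff_nat bit_code)
  have label_div: "label t X div 2 ^ Suc w = idx t X" if "t \<le> T" for t X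
  proof -
    have "drop_bit (Suc w) (label t X) = idx t X"
      by (rule bit_eqI) (use that in \<open>auto simp: bit_drop_bit_eq bit_label w_def\<close>)
    then show ?thesis by (simp only: drop_bit_eq_div)
  qed
  have label_less: "label t X < D" if "X \<subseteq> {..<n}" "t \<le> T" for t X
    using that bound[of X t] unfolding D_def qdim_def nat_less_power2_iff_bits
    by (auto simp: bit_label w_def)
  have mid_less: "mid t X < D" if "X \<subseteq> {..<n}" "t \<le> T" for t X
    unfolding mid_def D_def using label_less[OF that] by (intro oracle_target_less) (simp add: D_def)
  have bit_mid: "bit (mid t X) p \<longleftrightarrow> (if p = w then idx t X \<in> X else bit (label t X) p)"
    if X: "X \<subseteq> {..<n}" and t: "t < T" for t X p
  proof -
    \<comment> \<open>An index of \<open>n\<close> or more is answered 0 on both sides: the oracle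
      ignores it and \<open>X\<close> does not contain it.\<close>
    have ans: "(idx t X < n \<and> inp n X ! idx t X) \<longleftrightarrow> idx t X \<in> X" using X by auto
    have "\<not> bit (label t X) w" using t by (simp add: bit_label w_def)
    moreover have "mid t X = (if idx t X \<in> X then xor (label t X) (2 ^ w) else label t X)"
      using t unfolding mid_def oracle_target_def Let_def by (simp only: label_div less_imp_le ans)
    ultimately show ?thesis by (auto simp: bit_xor_iff bit_exp_iff)
  qed
  have label_eq: "label t X = label t Y \<longleftrightarrow> agree t X Y"
    if X: "X \<subseteq> {..<n}" and Y: "Y \<subseteq> {..<n}" and t: "t \<le> T" for t X Y
  proof
    assume eq: "label t X = label t Y"
    show "agree t X Y" unfolding agree_def
    proof (intro allI impI)
      fix s assume s: "s < t"
      then have "bit (label t X) s = (idx s X \<in> X)" "bit (label t Y) s = (idx s Y \<in> Y)"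
        using t by (auto simp: bit_label w_def)
      then show "(idx s X \<in> X) = (idx s Y \<in> Y)" using eq by simp
    qed
  next
    assume ag: "agree t X Y"
    then have "idx t X = idx t Y" using X Y by (intro determined) (auto simp: agree_def)
    then show "label t X = label t Y"
      using ag by (intro bit_eqI) (auto simp: bit_label agree_def)
  qed
  have mid_eq: "mid t X = mid t Y \<longleftrightarrow> agree (Suc t) X Y"
    if X: "X \<subseteq> {..<n}" and Y: "Y \<subseteq> {..<n}" and t: "t < T" for t X Y
  proof
    assume eq: "mid t X = mid t Y"
    show "agree (Suc t) X Y" unfolding agree_def
    proof (intro allI impI)
      fix s assume s: "s < Suc t"
      show "(idx s X \<in> X) = (idx s Y \<in> Y)"
      proof (cases "s = t")
        case True
        then show ?thesis using eq bit_mid[OF X t, of w] bit_mid[OF Y t, of w] by simp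
      next
        case False
        then show ?thesis using s t eq bit_mid[OF X t, of s] bit_mid[OF Y t, of s]
          by (auto simp: bit_label w_def)
      qed
    qed
  next
    assume ag: "agree (Suc t) X Y"
    then have "agree t X Y" by (simp add: agree_def)
    then have "label t X = label t Y" using label_eq[OF X Y] t by simp
    then show "mid t X = mid t Y"
      using ag by (intro bit_eqI) (auto simp: bit_mid[OF X t] bit_mid[OF Y t] agree_def)
  qed
  have ex_step: "\<exists>U. unitary_mat D U \<and>
      (t < T \<longrightarrow> (\<forall>X\<subseteq>{..<n}. U *\<^sub>v unit_vec D (mid t X) = unit_vec D (label (Suc t) X)))" for t
  proof (cases "t < T")
    case True
    define R where "R = mid t ` Pow {..<n}"
    define g where "g k = label (Suc t) (SOME X. X \<subseteq> {..<n} \<and> mid t X = k)" for k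
    have g_mid: "g (mid t X) = label (Suc t) X" if X: "X \<subseteq> {..<n}" for X
    proof -
      define Y where "Y = (SOME Y. Y \<subseteq> {..<n} \<and> mid t Y = mid t X)"
      have "Y \<subseteq> {..<n} \<and> mid t Y = mid t X" unfolding Y_def by (rule someI[of _ X]) (use X in simp)
      then have "label (Suc t) Y = label (Suc t) X"
        using mid_eq[of Y X t] label_eq[of Y X "Suc t"] X True by auto
      then show ?thesis by (simp add: g_def Y_def)
    qed
    have "R \<subseteq> {..<D}" using mid_less True by (auto simp: R_def)
    moreover have "inj_on g R"
    proof (rule inj_onI)
      fix k l assume "k \<in> R" "l \<in> R" and eq: "g k = g l"
      then obtain X Y where XY: "X \<subseteq> {..<n}" "Y \<subseteq> {..<n}" "k = mid t X" "l = mid t Y"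
        by (auto simp: R_def)
      then show "k = l"
        using eq g_mid mid_eq[of X Y t] label_eq[of X Y "Suc t"] True by auto
    qed
    moreover have "g ` R \<subseteq> {..<D}" using g_mid label_less True by (auto simp: R_def)
    ultimately obtain U where "unitary_mat D U" "\<forall>k\<in>R. U *\<^sub>v unit_vec D k = unit_vec D (g k)"
      using injective_map_extends_to_unitary[of R D g] by blast
    then show ?thesis using g_mid by (intro exI[of _ U]) (auto simp: R_def)
  next
    case False
    then show ?thesis using unitary_mat_one by blast
  qed
  then obtain Vs where Vs: "\<And>t. unitary_mat D (Vs t)"
    "\<And>t X. t < T \<Longrightarrow> X \<subseteq> {..<n} \<Longrightarrow> Vs t *\<^sub>v unit_vec D (mid t X) = unit_vec D (label (Suc t) X)"
    by metis
  have D0: "0 < D" by (simp add: D_def qdim_def)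
  obtain U0 where U0: "unitary_mat D U0" "U0 *\<^sub>v unit_vec D 0 = unit_vec D (label 0 {})"
    using injective_map_extends_to_unitary[of "{0}" D "\<lambda>_. label 0 {}"] label_less[of "{}" 0] D0 by auto
  define Us where "Us t = (case t of 0 \<Rightarrow> U0 | Suc s \<Rightarrow> Vs s)" for t
  have valid: "valid_alg n q w T Us"
    using n U0 Vs by (auto simp: valid_alg_def Us_def D_def split: nat.split)
  have state: "alg_state n q w Us (inp n X) t = unit_vec D (label t X)"
    if X: "X \<subseteq> {..<n}" and "t \<le> T" for X t
    using that(2)
  proof (induction t)
    case 0
    have "label 0 X = label 0 {}" using label_eq[OF X, of "{}" 0] by (simp add: agree_def)
    then show ?case using U0 by (simp add: Us_def D_def)
  next
    case (Suc t)
    have "oracle_mat n q w (inp n X) *\<^sub>v unit_vec D (label t X) = unit_vec D (mid t X)"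
      unfolding D_def mid_def
      by (rule oracle_mat_unit_vec) (use label_less[OF X, of t] Suc.prems in \<open>simp add: D_def\<close>)
    then show ?case using Suc Vs(2)[OF _ X, of t] by (simp add: Us_def)
  qed
  have same: "\<forall>s<T. idx s X = idx s Y \<and> (idx s X \<in> X) = (idx s Y \<in> Y)"
    if X: "X \<subseteq> {..<n}" and Y: "Y \<subseteq> {..<n}" and eq: "label T X = label T Y" for X Y
  proof -
    have ag: "agree T X Y" using label_eq[OF X Y] eq by simp
    then have "idx s X = idx s Y" if "s < T" for s
      using that by (intro determined[OF X Y]) (simp add: agree_def)
    then show ?thesis using ag by (simp add: agree_def)
  qed
  show ?thesis
  proof (rule exI[of _ w], rule exI[of _ Us], rule exI[of _ "label T"], intro conjI allI impI)
    fix X assume X: "X \<subseteq> {..<n}"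
    show "label T X < qdim q w" using label_less[OF X order_refl] by (simp only: D_def)
    show "alg_state n q w Us (inp n X) T = unit_vec (qdim q w) (label T X)"
      using state[OF X order_refl] by (simp only: D_def)
  next
    fix X Y s
    assume "X \<subseteq> {..<n}" "Y \<subseteq> {..<n}" "label T X = label T Y" "s < T"
    with same show "idx s X = idx s Y" "(idx s X \<in> X) = (idx s Y \<in> Y)" by blast+
  qed (rule valid)
qed

lemma inp_of_list:
  assumes "length x = n"
  shows "inp n {i. i < n \<and> x ! i} = x"
  using assms by (intro nth_equalityI) auto

lemma out_prob_unit_vec:
  assumes "alg_state n q w Us x T = unit_vec (qdim q w) l" "l < qdim q w"
  shows "out_prob n q w T Us dec x v = of_bool (dec l = v)"
proof -
  have "out_prob n q w T Us dec x v = (\<Sum>k\<in>{k. k < qdim q w \<and> dec k = v}. if k = l then 1 else 0)"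
    unfolding out_prob_def assms(1) by (rule sum.cong) (auto simp: assms(2))
  also have "\<dots> = of_bool (dec l = v)" using assms(2) by simp
  finally show ?thesis .
qed

section \<open>Query complexities\<close>

text \<open>Reading all \<open>n\<close> bits succeeds with certainty, so the minimum in
  \<open>Qb\<close> ranges over a nonempty set.\<close>

lemma query_all_algorithm:
  "\<exists>q w Us (dec :: nat \<Rightarrow> bool). valid_alg n q w n Us \<and>
     (\<forall>x. length x = n \<longrightarrow> out_prob n q w n Us dec x (f x) \<ge> 2/3)"
proof -
  define idx where "idx t (X :: nat set) = (if t < n then t else 0)" for t X
  have n: "n \<le> 2 ^ n" using less_exp[of n] by simp
  have bnd: "idx t X < 2 ^ n" for t X
    using n by (auto simp: idx_def intro: less_le_trans)
  obtain w Us L where valid: "valid_alg n n w n Us"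
    and st: "\<And>X. X \<subseteq> {..<n} \<Longrightarrow> L X < qdim n w \<and> alg_state n n w Us (inp n X) n = unit_vec (qdim n w) (L X)"
    and det: "\<And>X Y. X \<subseteq> {..<n} \<Longrightarrow> Y \<subseteq> {..<n} \<Longrightarrow> L X = L Y \<Longrightarrow>
       (\<forall>s<n. idx s X = idx s Y \<and> (idx s X \<in> X) = (idx s Y \<in> Y))"
    using adaptive_queries_simulation[OF n, of idx n] bnd unfolding idx_def by blast
  define dec where "dec k = (\<exists>X\<subseteq>{..<n}. L X = k \<and> f (inp n X))" for k
  have "out_prob n n w n Us dec x (f x) \<ge> 2/3" if x: "length x = n" for x
  proof -
    define X where "X = {i. i < n \<and> x ! i}"
    have X: "X \<subseteq> {..<n}" and xX: "inp n X = x" using inp_of_list[OF x] by (auto simp: X_def)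
    have "Y = X" if "Y \<subseteq> {..<n}" "L Y = L X" for Y
      using det[OF that(1) X that(2)] that(1) X by (auto simp: idx_def)
    then have "dec (L X) = f x" using X xX by (auto simp: dec_def)
    then show ?thesis using out_prob_unit_vec[of n n w Us x n "L X" dec "f x"] st[OF X] xX by simp
  qed
  then show ?thesis using valid by blast
qed

text \<open>Nothing is traced out. The decoder defines a diagonal unitary with entries 1 and -1,
  whose expectation is at least 1/3 on \<open>x\<close> and at most -1/3 on \<open>y\<close>. The
  trace norm is therefore at least 2/3 and the trace distance at least 1/3.\<close>

lemma bounded_error_distinguishes:
  fixes dec :: "nat \<Rightarrow> bool"
  assumes V: "valid_alg n q w T Us"
    and x: "out_prob n q w T Us dec x b \<ge> 2/3" and y: "out_prob n q w T Us dec y (\<not> b) \<ge> 2/3"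
  shows "trace_dist (qdim q w) (reduced_state n q w T Us {} x) (reduced_state n q w T Us {} y) \<ge> 1/6"
proof -
  let ?D = "qdim q w"
  let ?u = "alg_state n q w Us x T" and ?v = "alg_state n q w Us y T"
  have D0: "0 < ?D" by (simp add: qdim_def)
  have zero: "{s. s < ?D \<and> (\<forall>p. \<not> bit s p)} = {0}"
    using D0 by (auto simp: bit_eq_iff)
  have diag: "ptrace ?D {} \<chi> $$ (k, k) = complex_of_real ((cmod (\<chi> $ k))\<^sup>2)" if "k < ?D" for \<chi> k
    unfolding complex_norm_square using that by (simp add: ptrace_def zero)
  define \<sigma> :: "nat \<Rightarrow> real" where "\<sigma> k = (if dec k = b then 1 else - 1)" for k
  define W where "W = mat_diag ?D (\<lambda>k. complex_of_real (\<sigma> k))"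
  have Wc: "W \<in> carrier_mat ?D ?D" by (simp add: W_def)
  have "mat_adjoint W = W" by (rule eq_matI) (auto simp: W_def mat_diag_def)
  moreover have "W * W = mat_diag ?D (\<lambda>k. 1)"
    unfolding W_def mat_diag_diag by (rule arg_cong[of _ _ "mat_diag ?D"]) (auto simp: \<sigma>_def)
  ultimately have W: "unitary_mat ?D W" using Wc by (simp add: unitary_mat_def)
  define A where "A = ptrace ?D {} ?u - ptrace ?D {} ?v"
  have Ac: "A \<in> carrier_mat ?D ?D" unfolding A_def by (intro minus_carrier_mat ptrace_carrier)
  have Ah: "mat_adjoint A = A" unfolding A_def by (rule ptrace_diff_hermitian)
  have tot: "out_prob n q w T Us dec z True + out_prob n q w T Us dec z False = 1" for z
  proof -
    have "(\<Sum>k<?D. (cmod (alg_state n q w Us z T $ k))\<^sup>2) = 1"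
      using alg_state_norm[OF V order_refl, of z] vnorm_sq[of "alg_state n q w Us z T"]
        alg_state_carrier[OF V order_refl, of z] by simp
    moreover have "{..<?D} = {k. k < ?D \<and> dec k = True} \<union> {k. k < ?D \<and> dec k = False}" by auto
    ultimately show ?thesis
      unfolding out_prob_def by (subst sum.union_disjoint[symmetric]) auto
  qed
  have sgn: "(\<Sum>k<?D. (cmod (alg_state n q w Us z T $ k))\<^sup>2 * \<sigma> k) =
      out_prob n q w T Us dec z b - out_prob n q w T Us dec z (\<not> b)" for z
  proof -
    let ?B = "\<lambda>c. {k. k < ?D \<and> dec k = c}"
    let ?h = "\<lambda>k. (cmod (alg_state n q w Us z T $ k))\<^sup>2 * \<sigma> k"
    have "{..<?D} = ?B b \<union> ?B (\<not> b)" by auto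
    then have "sum ?h {..<?D} = sum ?h (?B b) + sum ?h (?B (\<not> b))"
      by (simp only:, intro sum.union_disjoint) auto
    also have "sum ?h (?B b) = out_prob n q w T Us dec z b"
      unfolding out_prob_def by (rule sum.cong) (auto simp: \<sigma>_def)
    also have "sum ?h (?B (\<not> b)) = - out_prob n q w T Us dec z (\<not> b)"
      unfolding out_prob_def sum_negf[symmetric] by (rule sum.cong) (auto simp: \<sigma>_def)
    finally show ?thesis by simp
  qed
  have "mat_tr (A * W) = (\<Sum>k<?D. A $$ (k, k) * complex_of_real (\<sigma> k))"
    unfolding W_def mat_diag_mult_right[OF Ac] by (simp add: mat_tr_def)
  also have "\<dots> = complex_of_real ((\<Sum>k<?D. (cmod (?u $ k))\<^sup>2 * \<sigma> k) - (\<Sum>k<?D. (cmod (?v $ k))\<^sup>2 * \<sigma> k))"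
    unfolding sum_subtractf[symmetric] of_real_sum
  proof (rule sum.cong)
    fix k assume "k \<in> {..<?D}"
    then have k: "k < ?D" by simp
    then have "A $$ (k, k) = complex_of_real ((cmod (?u $ k))\<^sup>2) - complex_of_real ((cmod (?v $ k))\<^sup>2)"
      using diag[OF k] by (simp add: A_def ptrace_def)
    then show "A $$ (k, k) * complex_of_real (\<sigma> k) =
        complex_of_real ((cmod (?u $ k))\<^sup>2 * \<sigma> k - (cmod (?v $ k))\<^sup>2 * \<sigma> k)"
      by (simp add: left_diff_distrib)
  qed simp
  finally have "cmod (mat_tr (A * W)) = \<bar>(out_prob n q w T Us dec x b - out_prob n q w T Us dec x (\<not> b))
      - (out_prob n q w T Us dec y b - out_prob n q w T Us dec y (\<not> b))\<bar>"
    unfolding sgn by (simp only: norm_of_real)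
  moreover have tot': "out_prob n q w T Us dec z b + out_prob n q w T Us dec z (\<not> b) = 1" for z
    using tot[of z] by (cases b) auto
  ultimately have "2/3 \<le> cmod (mat_tr (A * W))"
    using x y tot'[of x] tot'[of y] by linarith
  then have "2/3 \<le> trace_norm ?D A" using mat_tr_le_trace_norm[OF Ac Ah W] by linarith
  then show ?thesis by (simp add: trace_dist_def reduced_state_ptrace A_def)
qed

text \<open>Serves twice: it compares \<open>QS\<close> with \<open>Qb\<close>, and it shows that
  the minimum in \<open>QS\<close> is attained.\<close>

lemma QS_witness_from_Qb:
  "\<exists>q w Us S. valid_alg n q w (Qb n f) Us \<and> S \<subseteq> {..<q + 1 + w} \<and>
      (\<forall>x y. length x = n \<longrightarrow> length y = n \<longrightarrow> f x \<noteq> f y \<longrightarrow>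
         trace_dist (qdim q w) (reduced_state n q w (Qb n f) Us S x) (reduced_state n q w (Qb n f) Us S y) \<ge> 1/6)"
proof -
  have "\<exists>q w Us (dec :: nat \<Rightarrow> bool). valid_alg n q w (Qb n f) Us \<and>
      (\<forall>x. length x = n \<longrightarrow> out_prob n q w (Qb n f) Us dec x (f x) \<ge> 2/3)"
    unfolding Qb_def by (rule LeastI) (rule query_all_algorithm)
  then obtain q w Us and dec :: "nat \<Rightarrow> bool" where V: "valid_alg n q w (Qb n f) Us"
    and out: "\<And>x. length x = n \<Longrightarrow> out_prob n q w (Qb n f) Us dec x (f x) \<ge> 2/3" by blast
  have "trace_dist (qdim q w) (reduced_state n q w (Qb n f) Us {} x) (reduced_state n q w (Qb n f) Us {} y) \<ge> 1/6"
    if "length x = n" "length y = n" "f x \<noteq> f y" for x y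
    using bounded_error_distinguishes[OF V, of dec x "f x" y] out[of x] out[of y] that by simp
  then show ?thesis using V by blast
qed

lemma QS_le_Qb: "QS n f \<le> Qb n f"
  unfolding QS_def by (rule Least_le) (rule QS_witness_from_Qb)

lemma QS_witness:
  "\<exists>q w Us S. valid_alg n q w (QS n f) Us \<and> S \<subseteq> {..<q + 1 + w} \<and>
      (\<forall>x y. length x = n \<longrightarrow> length y = n \<longrightarrow> f x \<noteq> f y \<longrightarrow>
         trace_dist (qdim q w) (reduced_state n q w (QS n f) Us S x) (reduced_state n q w (QS n f) Us S y) \<ge> 1/6)"
  unfolding QS_def by (rule LeastI) (rule QS_witness_from_Qb)

lemma g5log_mono:
  assumes "s \<le> t"
  shows "g5log s \<le> g5log t"
proof (cases "s = 0")
  case True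
  then show ?thesis by (simp add: g5log_def)
next
  case False
  then have "log 2 (real s) \<le> log 2 (real t)" using assms by simp
  then show ?thesis
    unfolding g5log_def using assms by (intro mult_mono power_mono max.mono) auto
qed

text \<open>The run ends in the basis state \<open>L X\<close>. Any input with this label has seen
  the same queries and answers, so the decoder may choose one arbitrarily: value and certificate
  agree. \<open>None\<close> belongs only to labels that no input reaches.\<close>

lemma certifying_algorithm:
  "\<exists>q w Us (dec :: nat \<Rightarrow> (bool \<times> (nat \<Rightarrow> bool option)) option).
     valid_alg n q w ((144 * QS n f) ^ 4) Us \<and>
     (\<forall>x. length x = n \<longrightarrow>
        (\<forall>k<qdim q w. cmod (alg_state n q w Us x ((144 * QS n f) ^ 4) $ k) \<noteq> 0 \<longrightarrow>
           (case dec k of None \<Rightarrow> True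
            | Some (b, cert) \<Rightarrow> b = f x \<and> is_certificate n f x cert)) \<and>
        out_prob n q w ((144 * QS n f) ^ 4) Us dec x None \<le> 1/2)"
proof -
  define T where "T = QS n f"
  define N where "N = (144 * T) ^ 4"
  obtain q0 w0 Us0 S where "valid_alg n q0 w0 T Us0" "S \<subseteq> {..<q0 + 1 + w0}"
    "\<And>x y. length x = n \<Longrightarrow> length y = n \<Longrightarrow> f x \<noteq> f y \<Longrightarrow>
         trace_dist (qdim q0 w0) (reduced_state n q0 w0 T Us0 S x) (reduced_state n q0 w0 T Us0 S y) \<ge> 1/6"
    using QS_witness[of n f] unfolding T_def by blast
  from distinguisher_query_weights[OF this]
  interpret query_weights n "\<lambda>X. f (inp n X)" T 144
    "\<lambda>X t i. if t < T then index_mass w0 {i} (alg_state n q0 w0 Us0 (inp n X) t) else 0" .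
  have n: "n \<le> 2 ^ n" "max 1 n \<le> 2 ^ n" using less_exp[of n] by auto
  have bnd: "query_index t X < 2 ^ n" for t X
    using query_index_bound[of t X] n by linarith
  have sim: "\<exists>w Us L. valid_alg n n w N Us \<and>
    (\<forall>X. X \<subseteq> {..<n} \<longrightarrow> L X < qdim n w \<and> alg_state n n w Us (inp n X) N = unit_vec (qdim n w) (L X)) \<and>
    (\<forall>X Y. X \<subseteq> {..<n} \<longrightarrow> Y \<subseteq> {..<n} \<longrightarrow> L X = L Y \<longrightarrow>
       (\<forall>s<N. query_index s X = query_index s Y \<and> (query_index s X \<in> X) = (query_index s Y \<in> Y)))"
    by (rule adaptive_queries_simulation[OF n(1) bnd]) (rule query_index_determined)
  obtain w Us L where valid: "valid_alg n n w N Us"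
    and st: "\<And>X. X \<subseteq> {..<n} \<Longrightarrow> L X < qdim n w \<and> alg_state n n w Us (inp n X) N = unit_vec (qdim n w) (L X)"
    and det: "\<And>X Y. X \<subseteq> {..<n} \<Longrightarrow> Y \<subseteq> {..<n} \<Longrightarrow> L X = L Y \<Longrightarrow>
       (\<forall>s<N. query_index s X = query_index s Y \<and> (query_index s X \<in> X) = (query_index s Y \<in> Y))"
    using sim by (elim exE conjE) blast
  \<comment> \<open>The guard \<open>i < n\<close> matters when \<open>n\<close> is 0, where padding
    still queries index 0.\<close>
  define cert where "cert X i = (if i < n \<and> (\<exists>s<N. query_index s X = i) then Some (i \<in> X) else None)"
    for X i
  define dec where "dec k = (if \<exists>X\<subseteq>{..<n}. L X = k
      then (let X = SOME X. X \<subseteq> {..<n} \<and> L X = k in Some (f (inp n X), cert X)) else None)" for k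
  have dec_L: "dec (L X) = Some (f (inp n X), cert X)" if X: "X \<subseteq> {..<n}" for X
  proof -
    define Y where "Y = (SOME Y. Y \<subseteq> {..<n} \<and> L Y = L X)"
    have Y: "Y \<subseteq> {..<n} \<and> L Y = L X" unfolding Y_def by (rule someI[of _ X]) (use X in simp)
    have d: "query_index s Y = query_index s X" "(query_index s Y \<in> Y) = (query_index s X \<in> X)"
      if "s < N" for s using det[of Y X] Y X that by auto
    have "f (inp n Y) = f (inp n X)"
      by (rule queries_certify[OF X]) (use Y d in \<open>auto simp: N_def\<close>)
    moreover have "cert Y = cert X"
      using d by (intro ext) (auto simp: cert_def)
    ultimately show ?thesis using X unfolding dec_def Y_def[symmetric] Let_def by auto
  qed
  have certified: "is_certificate n f (inp n X) (cert X)" if X: "X \<subseteq> {..<n}" for X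
    unfolding is_certificate_def
  proof (intro conjI ballI allI impI)
    show "dom (cert X) \<subseteq> {..<n}" by (auto simp: cert_def split: if_splits)
    show "cert X i = Some (inp n X ! i)" if "i \<in> dom (cert X)" for i
      using that by (auto simp: cert_def split: if_splits)
    fix y assume y: "length y = n" and ag: "\<forall>i\<in>dom (cert X). cert X i = Some (y ! i)"
    define Y where "Y = {i. i < n \<and> y ! i}"
    have "f (inp n Y) = f (inp n X)"
    proof (rule queries_certify[OF X])
      fix t assume t: "t < (144 * T) ^ 4"
      show "(query_index t X \<in> Y) = (query_index t X \<in> X)"
      proof (cases "query_index t X < n")
        case True
        then have "cert X (query_index t X) = Some (query_index t X \<in> X)"
          using t by (auto simp: cert_def N_def)
        then have "y ! query_index t X = (query_index t X \<in> X)" using ag by (metis domI option.inject)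
        then show ?thesis using True by (simp add: Y_def)
      qed (use X in \<open>auto simp: Y_def\<close>)
    qed (auto simp: Y_def)
    then show "f y = f (inp n X)" using inp_of_list[OF y] by (simp add: Y_def)
  qed
  have "(\<forall>k<qdim n w. cmod (alg_state n n w Us x N $ k) \<noteq> 0 \<longrightarrow>
           (case dec k of None \<Rightarrow> True
            | Some (b, cert) \<Rightarrow> b = f x \<and> is_certificate n f x cert)) \<and>
        out_prob n n w N Us dec x None \<le> 1/2" if x: "length x = n" for x
  proof -
    define X where "X = {i. i < n \<and> x ! i}"
    have X: "X \<subseteq> {..<n}" and xX: "inp n X = x" using inp_of_list[OF x] by (auto simp: X_def)
    have s: "L X < qdim n w" "alg_state n n w Us x N = unit_vec (qdim n w) (L X)"
      using st[OF X] xX by auto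
    have "k = L X" if "k < qdim n w" "cmod (alg_state n n w Us x N $ k) \<noteq> 0" for k
      using that s by (auto simp: unit_vec_def split: if_splits)
    then show ?thesis
      using dec_L[OF X] certified[OF X] xX out_prob_unit_vec[OF s(2,1), of dec None] by auto
  qed
  then show ?thesis using valid unfolding N_def T_def by blast
qed

theorem theorem1:
  "\<exists>c>0. \<forall>n (f :: bool list \<Rightarrow> bool).
     real (Q0 n f) \<le> c * g5log (QS n f) \<and>
     g5log (QS n f) \<le> c * g5log (Qb n f) \<and>
     (\<exists>T q w Us (dec :: nat \<Rightarrow> (bool \<times> (nat \<Rightarrow> bool option)) option).
        real T \<le> c * g5log (QS n f) \<and> valid_alg n q w T Us \<and>
        (\<forall>x. length x = n \<longrightarrow>
           (\<forall>k<qdim q w. cmod (alg_state n q w Us x T $ k) \<noteq> 0 \<longrightarrow>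
              (case dec k of None \<Rightarrow> True
               | Some (b, cert) \<Rightarrow> b = f x \<and> is_certificate n f x cert)) \<and>
           out_prob n q w T Us dec x None \<le> 1/2))"
proof (rule exI[of _ "144 ^ 4"], intro conjI allI)
  fix n and f :: "bool list \<Rightarrow> bool"
  define t where "t = QS n f"
  define T where "T = (144 * t) ^ 4"
  from certifying_algorithm[of n f] obtain q w Us
    and dec :: "nat \<Rightarrow> (bool \<times> (nat \<Rightarrow> bool option)) option"
    where valid: "valid_alg n q w T Us"
    and correct: "\<And>x k. length x = n \<Longrightarrow> k < qdim q w \<Longrightarrow> cmod (alg_state n q w Us x T $ k) \<noteq> 0 \<Longrightarrow>
      (case dec k of None \<Rightarrow> True | Some (b, cert) \<Rightarrow> b = f x \<and> is_certificate n f x cert)"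
    and unknown: "\<And>x. length x = n \<Longrightarrow> out_prob n q w T Us dec x None \<le> 1/2"
    unfolding T_def t_def by blast
  \<comment> \<open>At \<open>t = 0\<close> the powers are not increasing in the exponent, but both
    vanish.\<close>
  have "real t ^ 4 \<le> real t ^ 5" by (cases "t = 0") (auto intro: power_increasing)
  also have "\<dots> \<le> g5log t" unfolding g5log_def by (simp add: mult_le_cancel_left1)
  finally have bound: "real T \<le> 144 ^ 4 * g5log (QS n f)"
    by (simp add: T_def power_mult_distrib t_def)
  have "Q0 n f \<le> T"
    unfolding Q0_def
  proof (rule Least_le, intro exI conjI allI impI)
    show "valid_alg n q w T Us" by (rule valid)
    fix x :: "bool list" assume x: "length x = n"
    show "out_prob n q w T Us (\<lambda>k. map_option fst (dec k)) x (Some (\<not> f x)) = 0"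
      unfolding out_prob_def
    proof (rule sum.neutral, rule ballI)
      fix k assume "k \<in> {k. k < qdim q w \<and> map_option fst (dec k) = Some (\<not> f x)}"
      then obtain cert where k: "k < qdim q w" "dec k = Some (\<not> f x, cert)" by auto
      then show "(cmod (alg_state n q w Us x T $ k))\<^sup>2 = 0" using correct[OF x k(1)] by auto
    qed
    show "out_prob n q w T Us (\<lambda>k. map_option fst (dec k)) x None \<le> 1/2"
      using unknown[OF x] by (simp add: out_prob_def)
  qed
  then show "real (Q0 n f) \<le> 144 ^ 4 * g5log (QS n f)" using bound by linarith
  have "1 * g5log (Qb n f) \<le> 144 ^ 4 * g5log (Qb n f)"
    by (intro mult_right_mono) (auto simp: g5log_def)
  with g5log_mono[OF QS_le_Qb[of n f]] show "g5log (QS n f) \<le> 144 ^ 4 * g5log (Qb n f)"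
    by simp
  show "\<exists>T q w Us (dec :: nat \<Rightarrow> (bool \<times> (nat \<Rightarrow> bool option)) option).
        real T \<le> 144 ^ 4 * g5log (QS n f) \<and> valid_alg n q w T Us \<and>
        (\<forall>x. length x = n \<longrightarrow>
           (\<forall>k<qdim q w. cmod (alg_state n q w Us x T $ k) \<noteq> 0 \<longrightarrow>
              (case dec k of None \<Rightarrow> True
               | Some (b, cert) \<Rightarrow> b = f x \<and> is_certificate n f x cert)) \<and>
           out_prob n q w T Us dec x None \<le> 1/2)"
    using bound valid correct unknown by blast
qed simp

end
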